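(* Let $\boldsymbol{\tau} = (\tau_n\colon \mathcal{A}_{n+1}^+\to \mathcal{A}_n^+)_{n\geq 0}$ be an everywhere growing directive sequence of finite alphabet rank, i.e. $\liminf_{n\to +\infty} \# \mathcal{A}_n < +\infty$, and let $(X,T)$ be the $\mathcal{S}$-adic subshift generated by $\boldsymbol{\tau}$. Suppose that $(X,T)$ is minimal. Then $\mathrm{Aut}(X,T)$ is virtually $\mathbb{Z}$.
   Context: Alphabets are finite sets. For an alphabet $\mathcal{A}$, $\mathcal{A}^+$ is the free semigroup of nonempty finite words over $\mathcal{A}$ under concatenation, and $|w|$ is the length of a word $w$. A directive sequence is a sequence $\boldsymbol{\tau}=(\tau_n\colon \mathcal{A}_{n+1}^+\to \mathcal{A}_n^+)_{n\ge 0}$ of semigroup morphisms, where each $\mathcal{A}_n$ is an alphabet. For $0\le n<N$ put $\tau_{[n,N)}=\tau_n\circ\tau_{n+1}\circ\cdots\circ\tau_{N-1}$. For a morphism $\tau\colon\mathcal{A}^+\to\mathcal{B}^+$ put $\langle\tau\rangle=\min_{a\in\mathcal{A}}|\tau(a)|$. The sequence $\boldsymbol{\tau}$ is everywhere growing if $\lim_{N\to+\infty}\langle\tau_{[0,N)}\rangle=+\infty$. The $\mathcal{S}$-adic subshift generated by $\boldsymbol{\tau}$ is the set $X=X_{\boldsymbol{\tau}}$ of all $x\in\mathcal{A}_0^{\mathbb{Z}}$ such that for every $k\in\mathbb{N}$ the word $x_{[-k,k]}$ occurs as a (contiguous) subword of $\tau_{[0,N)}(a)$ for some $N>0$ and $a\in\mathcal{A}_N$,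 together with the left shift $T((x_n)_{n\in\mathbb{Z}})=(x_{n+1})_{n\in\mathbb{Z}}$. The system $(X,T)$ is minimal if the orbit $\{T^nx:n\in\mathbb{Z}\}$ of every $x\in X$ is dense in $X$. $\mathrm{Aut}(X,T)$ is the group, under composition, of all homeomorphisms $\varphi\colon X\to X$ with $\varphi\circ T=T\circ\varphi$. It is said to be virtually $\mathbb{Z}$ if the quotient $\mathrm{Aut}(X,T)/\langle T\rangle$ is finite, where $\langle T\rangle$ is the subgroup generated by $T$. *)

theory Defs
  imports
    "HOL-Library.Sublist"
    "HOL-Library.Extended_Nat"
    "HOL-Library.Liminf_Limsup"
    "HOL-Analysis.Function_Topology"
    "HOL-Algebra.Bij"
    "HOL-Algebra.Generated_Groups"
begin

section \<open>Directive sequences\<close>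

definition words :: "'a set \<Rightarrow> 'a list set" where
  "words A = {w \<in> lists A. w \<noteq> []}"

definition semigroup_morphism :: "'a set \<Rightarrow> 'b set \<Rightarrow> ('a list \<Rightarrow> 'b list) \<Rightarrow> bool" where
  "semigroup_morphism A B f \<longleftrightarrow>
     (\<forall>w \<in> words A. f w \<in> words B) \<and>
     (\<forall>u \<in> words A. \<forall>v \<in> words A. f (u @ v) = f u @ f v)"

text \<open>The alphabets of a sequence are finite subsets of one type; this loses no generality, since
  countably many finite sets embed in a common one. The values of a morphism outside
  the nonempty words over its source alphabet are irrelevant.\<close>

definition directive_sequence :: "(nat \<Rightarrow> 'a set) \<Rightarrow> (nat \<Rightarrow> 'a list \<Rightarrow> 'a list) \<Rightarrow> bool" where
  "directive_sequence A \<tau> \<longleftrightarrow>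
     (\<forall>n. finite (A n)) \<and> (\<forall>n. semigroup_morphism (A (Suc n)) (A n) (\<tau> n))"

definition compose_range :: "(nat \<Rightarrow> 'a list \<Rightarrow> 'a list) \<Rightarrow> nat \<Rightarrow> nat \<Rightarrow> 'a list \<Rightarrow> 'a list" where
  "compose_range \<tau> n N = foldr (\<circ>) (map \<tau> [n..<N]) id"

definition min_length :: "'a set \<Rightarrow> ('a list \<Rightarrow> 'b list) \<Rightarrow> nat" where
  "min_length A f = Min ((\<lambda>a. length (f [a])) ` A)"

text \<open>\<^term>\<open>Min {}\<close> is a fixed, unspecified number, so a growing
  directive sequence automatically has all its alphabets nonempty.\<close>

definition everywhere_growing :: "(nat \<Rightarrow> 'a set) \<Rightarrow> (nat \<Rightarrow> 'a list \<Rightarrow> 'a list) \<Rightarrow> bool" where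
  "everywhere_growing A \<tau> \<longleftrightarrow>
     filterlim (\<lambda>N. min_length (A N) (compose_range \<tau> 0 N)) at_top sequentially"

definition finite_alphabet_rank :: "(nat \<Rightarrow> 'a set) \<Rightarrow> bool" where
  "finite_alphabet_rank A \<longleftrightarrow> liminf (\<lambda>n. enat (card (A n))) < \<infinity>"


section \<open>Topological dynamical systems\<close>

text \<open>A system is a topology \<open>Z\<close> together with a homeomorphism \<open>T\<close> of its carrier.
  Self-maps of the carrier are represented, as in \<^const>\<open>BijGroup\<close>, by functions that are
  \<^const>\<open>undefined\<close> outside it, so that equal maps are equal as functions.\<close>

definition minimal_system :: "'x topology \<Rightarrow> ('x \<Rightarrow> 'x) \<Rightarrow> bool" where
  "minimal_system Z T \<longleftrightarrow>
     (\<forall>x \<in> topspace Z.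
        Z closure_of {(T [^]\<^bsub>BijGroup (topspace Z)\<^esub> n) x |n::int. True} = topspace Z)"

definition Aut :: "'x topology \<Rightarrow> ('x \<Rightarrow> 'x) \<Rightarrow> ('x \<Rightarrow> 'x) monoid" where
  "Aut Z T = (BijGroup (topspace Z))\<lparr>carrier :=
     {\<phi> \<in> Bij (topspace Z).
        homeomorphic_map Z Z \<phi> \<and> (\<forall>x \<in> topspace Z. \<phi> (T x) = T (\<phi> x))}\<rparr>"

definition virtually_Z :: "'x topology \<Rightarrow> ('x \<Rightarrow> 'x) \<Rightarrow> bool" where
  "virtually_Z Z T \<longleftrightarrow> finite (carrier (Aut Z T Mod generate (Aut Z T) {T}))"


section \<open>The S-adic subshift\<close>

definition subshift :: "(nat \<Rightarrow> 'a set) \<Rightarrow> (nat \<Rightarrow> 'a list \<Rightarrow> 'a list) \<Rightarrow> (int \<Rightarrow> 'a) set" where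
  "subshift A \<tau> = {x. (\<forall>i. x i \<in> A 0) \<and>
     (\<forall>k::nat. \<exists>N>0. \<exists>a \<in> A N. sublist (map x [- int k..int k]) (compose_range \<tau> 0 N [a]))}"

definition subshift_topology ::
    "(nat \<Rightarrow> 'a set) \<Rightarrow> (nat \<Rightarrow> 'a list \<Rightarrow> 'a list) \<Rightarrow> (int \<Rightarrow> 'a) topology" where
  "subshift_topology A \<tau> =
     subtopology (product_topology (\<lambda>_. discrete_topology (A 0)) UNIV) (subshift A \<tau>)"

definition shift :: "(int \<Rightarrow> 'a) set \<Rightarrow> (int \<Rightarrow> 'a) \<Rightarrow> (int \<Rightarrow> 'a)" where
  "shift X = (\<lambda>x\<in>X. \<lambda>n. x (n + 1))"


section \<open>Basic facts\<close>

lemma topspace_subshift_topology [simp]: "topspace (subshift_topology A \<tau>) = subshift A \<tau>"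
  by (auto simp: subshift_topology_def subshift_def)

lemma sublist_window:
  assumes "k + j \<le> m" "k \<le> m + j"
  shows "sublist (map (\<lambda>i. x (i + j)) [- k..k]) (map x [- m..(m::int)])"
proof (cases "k < 0")
  case True
  then show ?thesis by simp
next
  case False
  have eq: "map (\<lambda>i. x (i + j)) [- k..k] = map x [- k + j..k + j]"
    by (rule nth_equalityI) (auto simp: nth_upto algebra_simps)
  have "[- m..m] = [- m..- k + j - 1] @ [- k + j..m]"
    using assms False by (intro upto_split1) auto
  also have "[- k + j..m] = [- k + j..k + j] @ [k + j + 1..m]"
    using assms False by (intro upto_split2) auto
  finally show ?thesis
    unfolding eq sublist_def by (metis map_append)
qed

lemma subshift_translate:
  assumes x: "x \<in> subshift A \<tau>"
  shows "(\<lambda>i. x (i + j)) \<in> subshift A \<tau>"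
  unfolding subshift_def mem_Collect_eq
proof (intro conjI allI)
  show "x (i + j) \<in> A 0" for i
    using x by (auto simp: subshift_def)
  fix k :: nat
  define m where "m = k + nat \<bar>j\<bar>"
  from x obtain N a where "N > 0" "a \<in> A N"
      "sublist (map x [- int m..int m]) (compose_range \<tau> 0 N [a])"
    unfolding subshift_def by blast
  moreover have "sublist (map (\<lambda>i. x (i + j)) [- int k..int k]) (map x [- int m..int m])"
    by (rule sublist_window) (auto simp: m_def)
  ultimately show "\<exists>N>0. \<exists>a\<in>A N.
      sublist (map (\<lambda>i. x (i + j)) [- int k..int k]) (compose_range \<tau> 0 N [a])"
    using sublist_order.order_trans by blast
qed

lemma shift_Bij: "shift (subshift A \<tau>) \<in> Bij (subshift A \<tau>)"
proof -
  have "bij_betw (shift (subshift A \<tau>)) (subshift A \<tau>) (subshift A \<tau>)"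
    by (rule bij_betw_byWitness[where f' = "\<lambda>x i. x (i + (-1))"])
       (use subshift_translate[of _ A \<tau> 1] subshift_translate[of _ A \<tau> "-1"]
         in \<open>auto simp: shift_def\<close>)
  then show ?thesis
    by (auto simp: Bij_def shift_def)
qed

lemma group_Aut: "group (Aut Z T)" if T: "T \<in> Bij (topspace Z)"
proof -
  let ?X = "topspace Z" and ?G = "BijGroup (topspace Z)"
  interpret group ?G by (rule group_BijGroup)
  have "subgroup (carrier (Aut Z T)) ?G"
  proof (rule subgroupI)
    show "carrier (Aut Z T) \<subseteq> carrier ?G"
      by (auto simp: Aut_def BijGroup_def)
    have "homeomorphic_map Z Z (\<lambda>x\<in>?X. x)"
      by (rule homeomorphic_map_eq[of _ _ id]) auto
    moreover have "T x \<in> ?X" if "x \<in> ?X" for x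
      using T that by (auto simp: Bij_def bij_betw_def)
    ultimately have "(\<lambda>x\<in>?X. x) \<in> carrier (Aut Z T)"
      by (simp add: Aut_def id_Bij)
    then show "carrier (Aut Z T) \<noteq> {}" by blast
  next
    fix f assume f: "f \<in> carrier (Aut Z T)"
    then have fB: "f \<in> Bij ?X" and fh: "homeomorphic_map Z Z f"
      and fT: "\<And>x. x \<in> ?X \<Longrightarrow> f (T x) = T (f x)"
      by (auto simp: Aut_def)
    have inv: "inv\<^bsub>?G\<^esub> f = (\<lambda>x\<in>?X. (inv_into ?X f) x)"
      by (rule inv_BijGroup[OF fB])
    have bij: "bij_betw f ?X ?X" using fB by (auto simp: Bij_def)
    have TX: "T x \<in> ?X" if "x \<in> ?X" for x
      using T that by (auto simp: Bij_def bij_betw_def)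
    obtain g where g: "homeomorphic_maps Z Z f g"
      using fh homeomorphic_map_maps by blast
    have gi: "g x = inv_into ?X f x" if "x \<in> ?X" for x
      using g that bij
      by (metis bij_betw_inv_into_left continuous_map_image_subset_topspace homeomorphic_maps_def
          image_subset_iff)
    have "homeomorphic_map Z Z g"
      using g homeomorphic_maps_map by blast
    then have "homeomorphic_map Z Z (\<lambda>x\<in>?X. (inv_into ?X f) x)"
      by (rule homeomorphic_map_eq) (auto simp: gi)
    moreover have "inv_into ?X f (T x) = T (inv_into ?X f x)" if x: "x \<in> ?X" for x
    proof -
      let ?y = "inv_into ?X f x"
      have y: "?y \<in> ?X" "f ?y = x"
        using bij x by (auto simp: bij_betw_def inv_into_into f_inv_into_f)
      then have "f (T ?y) = T x" using fT by simp
      then show ?thesis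
        using bij y TX by (metis bij_betw_inv_into_left)
    qed
    moreover have "inv_into ?X f x \<in> ?X" if "x \<in> ?X" for x
      using bij that by (auto simp: bij_betw_def inv_into_into)
    ultimately show "inv\<^bsub>?G\<^esub> f \<in> carrier (Aut Z T)"
      unfolding inv using restrict_inv_into_Bij[OF fB] TX by (auto simp: Aut_def)
  next
    fix f g assume fg: "f \<in> carrier (Aut Z T)" "g \<in> carrier (Aut Z T)"
    have mult: "f \<otimes>\<^bsub>?G\<^esub> g = compose ?X f g"
      using fg by (auto simp: Aut_def BijGroup_def)
    have TX: "T x \<in> ?X" if "x \<in> ?X" for x
      using T that by (auto simp: Bij_def bij_betw_def)
    have gX: "g x \<in> ?X" if "x \<in> ?X" for x
      using fg that by (auto simp: Aut_def Bij_def bij_betw_def)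
    have "homeomorphic_map Z Z (f \<circ> g)"
      using fg by (auto simp: Aut_def intro: homeomorphic_map_compose)
    then have "homeomorphic_map Z Z (compose ?X f g)"
      by (rule homeomorphic_map_eq) (auto simp: compose_def)
    then show "f \<otimes>\<^bsub>?G\<^esub> g \<in> carrier (Aut Z T)"
      unfolding mult using fg TX gX by (auto simp: Aut_def compose_Bij compose_eq)
  qed
  then have "group (?G\<lparr>carrier := carrier (Aut Z T)\<rparr>)"
    by (rule subgroup_imp_group)
  then show ?thesis by (simp add: Aut_def)
qed

lemma shift_in_Aut:
  "shift (subshift A \<tau>) \<in> carrier (Aut (subshift_topology A \<tau>) (shift (subshift A \<tau>)))"
proof -
  let ?X = "subshift A \<tau>" and ?P = "product_topology (\<lambda>_::int. discrete_topology (A 0)) UNIV"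
  have cont: "continuous_map (subshift_topology A \<tau>) (subshift_topology A \<tau>) (\<lambda>x i. x (i + j))"
    for j
  proof -
    have "continuous_map ?P ?P (\<lambda>x i. x (i + j))"
      unfolding continuous_map_componentwise_UNIV
      by (auto intro: continuous_map_product_projection)
    then show ?thesis
      unfolding subshift_topology_def
      by (intro continuous_map_into_subtopology continuous_map_from_subtopology)
         (auto intro: subshift_translate)
  qed
  have "homeomorphic_maps (subshift_topology A \<tau>) (subshift_topology A \<tau>)
      (\<lambda>x i. x (i + 1)) (\<lambda>x i. x (i + (-1)))"
    unfolding homeomorphic_maps_def using cont[of 1] cont[of "-1"] by auto
  then have "homeomorphic_map (subshift_topology A \<tau>) (subshift_topology A \<tau>) (\<lambda>x i. x (i + 1))"
    by (rule homeomorphic_maps_imp_map)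
  then have "homeomorphic_map (subshift_topology A \<tau>) (subshift_topology A \<tau>) (shift ?X)"
    by (rule homeomorphic_map_eq) (auto simp: shift_def)
  then show ?thesis
    using shift_Bij by (auto simp: Aut_def)
qed

lemma shift_int_pow:
  assumes x: "x \<in> subshift A \<tau>"
  shows "(shift (subshift A \<tau>) [^]\<^bsub>BijGroup (subshift A \<tau>)\<^esub> (n::int)) x = (\<lambda>i. x (i + n))"
proof -
  let ?X = "subshift A \<tau>" and ?G = "BijGroup (subshift A \<tau>)" and ?T = "shift (subshift A \<tau>)"
  interpret group ?G by (rule group_BijGroup)
  have T: "?T \<in> carrier ?G" using shift_Bij by (auto simp: BijGroup_def)
  define S where "S j = (\<lambda>x\<in>?X. \<lambda>i. x (i + j))" for j :: int
  have SB: "S j \<in> carrier ?G" for j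
  proof -
    have "bij_betw (S j) ?X ?X"
      by (rule bij_betw_byWitness[where f' = "\<lambda>x i. x (i + (-j))"])
         (use subshift_translate[of _ A \<tau> j] subshift_translate[of _ A \<tau> "-j"]
           in \<open>auto simp: S_def\<close>)
    then show ?thesis by (auto simp: Bij_def BijGroup_def S_def)
  qed
  have mult: "S i \<otimes>\<^bsub>?G\<^esub> S j = S (i + j)" for i j
  proof -
    have "S i \<otimes>\<^bsub>?G\<^esub> S j = compose ?X (S i) (S j)"
      using SB by (simp add: BijGroup_def)
    also have "\<dots> = S (i + j)"
      by (rule ext) (auto simp: compose_def S_def restrict_def add_ac dest: subshift_translate[where j=j])
    finally show ?thesis .
  qed
  have one: "\<one>\<^bsub>?G\<^esub> = S 0"
    by (auto simp: BijGroup_def S_def)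
  have T1: "?T = S 1" by (simp add: shift_def S_def)
  have nat: "?T [^]\<^bsub>?G\<^esub> (m::nat) = S (int m)" for m
    by (induction m) (auto simp: one T1 mult add_ac)
  have inv: "inv\<^bsub>?G\<^esub> S j = S (- j)" for j
    using mult[of "-j" j] one SB by (intro inv_equality) auto
  have "?T [^]\<^bsub>?G\<^esub> n = S n"
    by (cases "n \<ge> 0") (auto simp: int_pow_def2 nat inv)
  then show ?thesis using x by (simp add: S_def)
qed

end

theory Submission
  imports Defs
begin

text \<open>Let \<open>W\<close> be the set of images of the letters of level \<open>n\<close>, at most \<open>K\<close> words, all of them long;
  every point of the subshift is a concatenation of words of \<open>W\<close>. If \<open>x\<close> and \<open>y\<close> agree on the right
  half line and differ just before it, then for suitable parses they have a common cut to the right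
  of the place where they differ, and one can read both leftwards from that cut. In the finite
  graph of positions inside words of \<open>W\<close> (with the word to the right remembered), identify
  vertices reached from the same vertex by the same letter. This never increases the number of
  edges minus the number of vertices, so the resulting deterministic graph has at most \<open>K\<^sup>3\<close> branching
  vertices, and \<open>x\<close> and \<open>y\<close> part at one of them. Hence the common right tails have at most
  \<open>K\<^sup>3\<close> prefixes of any given length, and there are at most \<open>K\<^sup>3\<close> such tails. No recognizability of the
  morphisms is needed.

  An infinite subshift has such a pair \<open>x\<close>, \<open>y\<close>. An automorphism maps it to another one up to a
  translation, and by minimality it is determined, modulo the shift, by the common tail of
  the image. So there are at most \<open>K\<^sup>3\<close> classes modulo the shift.\<close>

section \<open>Compactness and folding\<close>

text \<open>Diagonal pigeonhole: a window of finite radius takes finitely many values, so nested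
  infinite index sets can be chosen on which it is constant. Infinitely many \<open>k\<close> match
  each window, so callers may also ask for \<open>k\<close> to be large.\<close>

lemma konig_int:
  fixes f :: "nat \<Rightarrow> int \<Rightarrow> 'b"
  assumes B: "finite B" and f: "\<And>k i. f k i \<in> B"
  obtains g where "\<And>m. infinite {k. \<forall>i. \<bar>i\<bar> \<le> int m \<longrightarrow> f k i = g i}" "\<And>i. g i \<in> B"
proof -
  define r where "r m k = map (f k) [- int m..int m]" for m k
  have step: "\<exists>k. infinite {k' \<in> S. r m k' = r m k} \<and> k \<in> S" if "infinite S" for S :: "nat set" and m
  proof -
    have "r m ` S \<subseteq> {xs. set xs \<subseteq> B \<and> length xs = length [- int m..int m]}"
      using f by (auto simp: r_def)
    then have "finite (r m ` S)"
      using finite_lists_length_eq[OF B] finite_subset by blast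
    from pigeonhole_infinite[OF that this] show ?thesis
      by (metis (no_types, lifting) Collect_cong)
  qed
  define c where "c m S = (SOME k. infinite {k' \<in> S. r m k' = r m k} \<and> k \<in> S)" for m S
  define S where "S = rec_nat (UNIV::nat set) (\<lambda>m S. {k' \<in> S. r m k' = r m (c m S)})"
  have S0: "S 0 = UNIV" and SS: "S (Suc m) = {k' \<in> S m. r m k' = r m (c m (S m))}" for m
    by (simp_all add: S_def)
  have inf: "infinite (S m)" for m
  proof (induction m)
    case (Suc m)
    from someI_ex[OF step[OF Suc, of m]] show ?case by (simp add: SS c_def)
  qed (simp add: S0)
  have dec: "S (m + d) \<subseteq> S m" for m d
    by (induction d) (auto simp: SS)
  have eq: "f k i = f k' i" if "k \<in> S (Suc m)" "k' \<in> S (Suc m)" "\<bar>i\<bar> \<le> int m" for m k k' i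
  proof -
    have "r m k = r m k'" using that by (simp add: SS)
    moreover have "i \<in> set [- int m..int m]" using that by auto
    ultimately show ?thesis by (simp add: r_def)
  qed
  define e where "e m = (SOME k. k \<in> S (Suc m))" for m
  have e: "e m \<in> S (Suc m)" for m
    unfolding e_def by (rule someI_ex) (use inf[of "Suc m"] infinite_imp_nonempty in blast)
  \<comment> \<open>All indices in \<open>S (Suc m)\<close> show the same letters up to radius
    \<open>m\<close>, so each coordinate can be read from any index deep enough.\<close>
  define g where "g i = f (e (nat \<bar>i\<bar>)) i" for i
  have g: "f k i = g i" if "k \<in> S (Suc m)" "\<bar>i\<bar> \<le> int m" for k i m
  proof -
    have "nat \<bar>i\<bar> \<le> m" using that by simp
    then have "S (Suc m) \<subseteq> S (Suc (nat \<bar>i\<bar>))" using dec[of "Suc (nat \<bar>i\<bar>)" "m - nat \<bar>i\<bar>"] by simp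
    then show ?thesis unfolding g_def using eq[OF _ e, of k "nat \<bar>i\<bar>" i] that by auto
  qed
  show ?thesis
  proof (rule that[of g])
    show "infinite {k. \<forall>i. \<bar>i\<bar> \<le> int m \<longrightarrow> f k i = g i}" for m
      by (rule infinite_super[OF _ inf[of "Suc m"]]) (use g in auto)
    show "g i \<in> B" for i by (simp add: g_def f)
  qed
qed

text \<open>Identifying two targets of edges with the same source and label removes one vertex and at
  least one edge.\<close>

lemma fold_graph:
  fixes V :: "'v set" and E :: "('v \<times> 'l \<times> 'v) set" and g :: "'v \<Rightarrow> 'g"
  assumes "finite V" "finite E" "E \<subseteq> V \<times> UNIV \<times> V"
    and "\<And>s a t s' t'. (s, a, t) \<in> E \<Longrightarrow> (s', a, t') \<in> E \<Longrightarrow> g s = g s' \<Longrightarrow> g t = g t'"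
  shows "\<exists>f. f ` V \<subseteq> V \<and> (\<forall>v \<in> V. g (f v) = g v) \<and>
    (\<forall>s a t s' t'. (s, a, t) \<in> E \<longrightarrow> (s', a, t') \<in> E \<longrightarrow> f s = f s' \<longrightarrow> f t = f t') \<and>
    card ((\<lambda>(s, a, t). (f s, a, f t)) ` E) + card V \<le> card E + card (f ` V)"
  using assms
proof (induction "card V" arbitrary: V E rule: less_induct)
  case less
  show ?case
  proof (cases "\<forall>s a t t'. (s, a, t) \<in> E \<longrightarrow> (s, a, t') \<in> E \<longrightarrow> t = t'")
    case True
    have "(\<lambda>(s, a, t). (s, a, t)) ` E = E" by auto
    with True show ?thesis by (intro exI[of _ "\<lambda>v. v"]) auto
  next
    case False
    then obtain s a t t' where st: "(s, a, t) \<in> E" "(s, a, t') \<in> E" "t \<noteq> t'" by blast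
    define h where "h v = (if v = t' then t else v)" for v
    define h3 where "h3 = (\<lambda>(x, b::'l, y). (h x, b, h y))"
    have tV: "t \<in> V" "t' \<in> V" using st less.prems(3) by auto
    \<comment> \<open>The hypothesis with equal sources gives \<open>g t = g t'\<close>, so
      \<open>g\<close> passes to the quotient and the induction hypothesis applies with the same
      \<open>g\<close>.\<close>
    have gh: "g (h v) = g v" for v
      using less.prems(4)[OF st(1,2)] by (simp add: h_def)
    have hV: "h ` V = V - {t'}" using tV st by (auto simp: h_def)
    have cV: "card (h ` V) + 1 = card V"
      using hV tV less.prems(1) by (metis Suc_eq_plus1 card_Suc_Diff1)
    have "h3 ` E = h3 ` (E - {(s, a, t')})"
    proof -
      have "h3 (s, a, t') = h3 (s, a, t)" by (simp add: h3_def h_def)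
      moreover have "(s, a, t) \<in> E - {(s, a, t')}" using st by auto
      ultimately show ?thesis by (metis (no_types, lifting) image_insert insert_Diff st(2) insert_absorb imageI)
    qed
    then have "card (h3 ` E) \<le> card (E - {(s, a, t')})"
      using less.prems(2) by (simp add: card_image_le)
    then have cE: "card (h3 ` E) + 1 \<le> card E"
      using st less.prems(2) by (metis Suc_eq_plus1 card_Suc_Diff1 Suc_le_mono)
    have ex: "\<exists>f. f ` (h ` V) \<subseteq> h ` V \<and> (\<forall>v \<in> h ` V. g (f v) = g v) \<and>
      (\<forall>s a t s' t'. (s, a, t) \<in> h3 ` E \<longrightarrow> (s', a, t') \<in> h3 ` E \<longrightarrow> f s = f s' \<longrightarrow> f t = f t') \<and>
      card ((\<lambda>(s, a, t). (f s, a, f t)) ` (h3 ` E)) + card (h ` V) \<le> card (h3 ` E) + card (f ` (h ` V))"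
    proof (rule less.hyps)
      show "card (h ` V) < card V" using cV by simp
      show "finite (h ` V)" "finite (h3 ` E)" using less.prems by auto
      show "h3 ` E \<subseteq> h ` V \<times> UNIV \<times> h ` V" using less.prems(3) by (fastforce simp: h3_def)
      show "g t = g t'" if "(s, a, t) \<in> h3 ` E" "(s', a, t') \<in> h3 ` E" "g s = g s'" for s a t s' t'
      proof -
        from that obtain s0 t0 s0' t0' where "(s0, a, t0) \<in> E" "s = h s0" "t = h t0"
          "(s0', a, t0') \<in> E" "s' = h s0'" "t' = h t0'"
          unfolding h3_def by force
        then show ?thesis using less.prems(4) that(3) by (metis gh)
      qed
    qed
    then obtain f where f: "f ` (h ` V) \<subseteq> h ` V" "\<forall>v \<in> h ` V. g (f v) = g v"
      "\<forall>s a t s' t'. (s, a, t) \<in> h3 ` E \<longrightarrow> (s', a, t') \<in> h3 ` E \<longrightarrow> f s = f s' \<longrightarrow> f t = f t'"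
      "card ((\<lambda>(s, a, t). (f s, a, f t)) ` (h3 ` E)) + card (h ` V) \<le> card (h3 ` E) + card (f ` (h ` V))"
      by blast
    have im: "(\<lambda>(s, a, t). (f s, a, f t)) ` (h3 ` E) = (\<lambda>(s, a, t). ((f \<circ> h) s, a, (f \<circ> h) t)) ` E"
      unfolding image_image by (rule image_cong) (auto simp: h3_def)
    show ?thesis
    proof (intro exI[of _ "f \<circ> h"] conjI allI impI)
      have "(f \<circ> h) ` V = f ` (h ` V)" by (simp only: image_comp)
      also have "\<dots> \<subseteq> V" using f(1) hV by blast
      finally show "(f \<circ> h) ` V \<subseteq> V" .
      show "\<forall>v\<in>V. g ((f \<circ> h) v) = g v" using f(2) gh by auto
      show "(f \<circ> h) t = (f \<circ> h) t'" if "(s, a, t) \<in> E" "(s', a, t') \<in> E" "(f \<circ> h) s = (f \<circ> h) s'" for s a t s' t'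
      proof -
        have "(h s, a, h t) \<in> h3 ` E" "(h s', a, h t') \<in> h3 ` E"
          using that(1,2) unfolding h3_def by force+
        then show ?thesis using f(3) that(3) by (metis comp_apply)
      qed
      show "card ((\<lambda>(s, a, t). ((f \<circ> h) s, a, (f \<circ> h) t)) ` E) + card V \<le> card E + card ((f \<circ> h) ` V)"
        using f(4) cE cV unfolding im image_comp[of f h V] by linarith
    qed
  qed
qed

section \<open>Parses of bi-infinite words\<close>

text \<open>A parse is recorded by its set of cuts, not by a sequence of words: gluing and
  translation become set operations, and limits can be taken coordinate by coordinate.\<close>

definition word_at :: "'a list set \<Rightarrow> (int \<Rightarrow> 'a) \<Rightarrow> int set \<Rightarrow> int \<Rightarrow> 'a list \<Rightarrow> bool" where
  "word_at W x C c w \<longleftrightarrow> w \<in> W \<and> c \<in> C \<and> c + int (length w) \<in> C \<and>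
     {c<..<c + int (length w)} \<inter> C = {} \<and> (\<forall>j<length w. x (c + int j) = w ! j)"

definition parsed_at :: "'a list set \<Rightarrow> (int \<Rightarrow> 'a) \<Rightarrow> int set \<Rightarrow> int \<Rightarrow> bool" where
  "parsed_at W x C i \<longleftrightarrow> (\<exists>c w. word_at W x C c w \<and> c \<le> i \<and> i < c + int (length w))"

definition parse :: "'a list set \<Rightarrow> (int \<Rightarrow> 'a) \<Rightarrow> int set \<Rightarrow> bool" where
  "parse W x C \<longleftrightarrow> (\<forall>i. parsed_at W x C i)"

lemma word_at_cong:
  assumes "\<And>i. c \<le> i \<Longrightarrow> i \<le> c + int (length w) \<Longrightarrow> i \<in> C \<longleftrightarrow> i \<in> D"
    and "\<And>i. c \<le> i \<Longrightarrow> i < c + int (length w) \<Longrightarrow> x i = y i"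
  shows "word_at W x C c w \<longleftrightarrow> word_at W y D c w"
proof -
  have "c \<in> C \<longleftrightarrow> c \<in> D" "c + int (length w) \<in> C \<longleftrightarrow> c + int (length w) \<in> D"
    using assms(1) by auto
  moreover have "{c<..<c + int (length w)} \<inter> C = {c<..<c + int (length w)} \<inter> D"
    using assms(1) by auto
  moreover have "x (c + int j) = y (c + int j)" if "j < length w" for j
    using assms(2) that by auto
  ultimately show ?thesis unfolding word_at_def by auto
qed

lemma word_at_shift:
  "word_at W (\<lambda>i. x (i + n)) {i. i + n \<in> C} c w \<longleftrightarrow> word_at W x C (c + n) w"
proof -
  have "{c<..<c + int (length w)} \<inter> {i. i + n \<in> C} = {} \<longleftrightarrow>
      {c + n<..<c + n + int (length w)} \<inter> C = {}" (is "?l = {} \<longleftrightarrow> ?r = {}")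
  proof -
    have "?r = (\<lambda>i. i + n) ` ?l"
    proof (intro Set.set_eqI iffI)
      fix i assume "i \<in> ?r"
      then have "i - n \<in> ?l" by auto
      then show "i \<in> (\<lambda>i. i + n) ` ?l" by (rule rev_image_eqI) simp
    qed auto
    then show ?thesis by simp
  qed
  then show ?thesis unfolding word_at_def by (auto simp: algebra_simps)
qed

lemma parsed_at_shift:
  "parsed_at W (\<lambda>i. x (i + n)) {i. i + n \<in> C} i \<longleftrightarrow> parsed_at W x C (i + n)"
proof
  assume "parsed_at W x C (i + n)"
  then obtain c w where "word_at W x C c w" "c \<le> i + n" "i + n < c + int (length w)"
    unfolding parsed_at_def by blast
  then have "word_at W (\<lambda>i. x (i + n)) {i. i + n \<in> C} (c - n) w" "c - n \<le> i"
      "i < c - n + int (length w)"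
    by (auto simp: word_at_shift)
  then show "parsed_at W (\<lambda>i. x (i + n)) {i. i + n \<in> C} i" unfolding parsed_at_def by blast
next
  assume "parsed_at W (\<lambda>i. x (i + n)) {i. i + n \<in> C} i"
  then obtain c w where "word_at W x C (c + n) w" "c \<le> i" "i < c + int (length w)"
    unfolding parsed_at_def word_at_shift by blast
  then show "parsed_at W x C (i + n)"
    unfolding parsed_at_def by (intro exI[of _ "c + n"] exI[of _ w]) auto
qed

text \<open>The word covering \<open>i\<close> has length at most \<open>m\<close>, so it and both
  its end cuts lie within distance \<open>m\<close> of \<open>i\<close>.\<close>

lemma parsed_at_cong:
  assumes "parsed_at W x C i" "\<And>w. w \<in> W \<Longrightarrow> length w \<le> m"
    and "\<And>j. \<bar>j - i\<bar> \<le> int m \<Longrightarrow> j \<in> C \<longleftrightarrow> j \<in> D"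
    and "\<And>j. \<bar>j - i\<bar> \<le> int m \<Longrightarrow> x j = y j"
  shows "parsed_at W y D i"
proof -
  from assms(1) obtain c w where cw: "word_at W x C c w" "c \<le> i" "i < c + int (length w)"
    unfolding parsed_at_def by blast
  then have "length w \<le> m" using assms(2) by (simp add: word_at_def)
  then have "word_at W y D c w"
    using cw assms(3,4) by (subst word_at_cong[of _ _ D C y x]) auto
  then show ?thesis using cw unfolding parsed_at_def by blast
qed

lemma word_at_interior:
  "word_at W x C c w \<Longrightarrow> c < b \<Longrightarrow> b < c + int (length w) \<Longrightarrow> b \<notin> C"
  unfolding word_at_def by (metis IntI empty_iff greaterThanLessThan_iff)

text \<open>The word covering a cut cannot have it in its interior, so it starts there.\<close>

lemma word_at_cut:
  assumes "parsed_at W x C b" "b \<in> C"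
  shows "\<exists>w. word_at W x C b w \<and> w \<noteq> []"
proof -
  from assms(1) obtain c w where cw: "word_at W x C c w" "c \<le> b" "b < c + int (length w)"
    unfolding parsed_at_def by blast
  then have "\<not> c < b" using assms(2) word_at_interior by fastforce
  then have "c = b" using cw by simp
  then show ?thesis using cw by (intro exI[of _ w]) auto
qed

lemma word_before_cut:
  assumes "parsed_at W x C (b - 1)" "b \<in> C"
  shows "\<exists>w. word_at W x C (b - int (length w)) w \<and> w \<noteq> []"
proof -
  from assms(1) obtain c w where cw: "word_at W x C c w" "c \<le> b - 1" "b - 1 < c + int (length w)"
    unfolding parsed_at_def by blast
  then have "\<not> b < c + int (length w)" using assms(2) word_at_interior by fastforce
  then have "c = b - int (length w)" "w \<noteq> []" using cw by auto
  then show ?thesis using cw by blast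
qed

text \<open>Since \<open>b\<close> is a cut of both parses, no word of either crosses it; so the
  words of \<open>D\<close> before \<open>b\<close> can be followed by those of \<open>C\<close>
  after \<open>b\<close>, where \<open>x\<close> and \<open>y\<close> agree.\<close>

lemma parse_glue:
  assumes x: "parse W x C" and y: "parse W y D" and b: "b \<in> C" "b \<in> D"
    and eq: "\<And>i. b \<le> i \<Longrightarrow> x i = y i"
  shows "parse W y (D \<inter> {..b} \<union> C \<inter> {b..})"
  unfolding parse_def
proof
  fix i
  show "parsed_at W y (D \<inter> {..b} \<union> C \<inter> {b..}) i"
  proof (cases "b \<le> i")
    case True
    from x obtain c w where cw: "word_at W x C c w" "c \<le> i" "i < c + int (length w)"
      unfolding parse_def parsed_at_def by blast
    then have "\<not> c < b" using b True word_at_interior by fastforce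
    have "i \<in> D \<inter> {..b} \<union> C \<inter> {b..} \<longleftrightarrow> i \<in> C" if "c \<le> i" for i
      using that b \<open>\<not> c < b\<close> by (cases "i = b") auto
    then have "word_at W y (D \<inter> {..b} \<union> C \<inter> {b..}) c w"
      using cw eq \<open>\<not> c < b\<close> by (subst word_at_cong[of _ _ _ C _ x]) auto
    then show ?thesis using cw unfolding parsed_at_def by blast
  next
    case False
    from y obtain c w where cw: "word_at W y D c w" "c \<le> i" "i < c + int (length w)"
      unfolding parse_def parsed_at_def by blast
    then have "\<not> b < c + int (length w)" using b False word_at_interior by fastforce
    have "i \<in> D \<inter> {..b} \<union> C \<inter> {b..} \<longleftrightarrow> i \<in> D" if "i \<le> c + int (length w)" for i
      using that b \<open>\<not> b < c + int (length w)\<close> by (cases "i = b") auto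
    then have "word_at W y (D \<inter> {..b} \<union> C \<inter> {b..}) c w"
      using cw by (subst word_at_cong[of _ _ _ D _ y]) auto
    then show ?thesis using cw unfolding parsed_at_def by blast
  qed
qed

section \<open>Families of pairwise disjoint parses\<close>

text \<open>Disjoint parses are encoded by one function into subsets of \<open>{..<r}\<close>, so that a single
  compactness argument produces the whole family.\<close>

lemma disjoint_parses_limit:
  fixes r :: nat
  assumes len: "\<And>w. w \<in> W \<Longrightarrow> length w \<le> m"
    and F: "\<And>k. \<exists>F. (\<forall>j<r. \<forall>i. \<bar>i\<bar> \<le> int k \<longrightarrow> parsed_at W v (F j) i) \<and>
      (\<forall>j<r. \<forall>j'<r. j \<noteq> j' \<longrightarrow> F j \<inter> F j' \<inter> {- int k..int k} = {})"
  shows "\<exists>F. (\<forall>j<r. parse W v (F j)) \<and> (\<forall>j<r. \<forall>j'<r. j \<noteq> j' \<longrightarrow> F j \<inter> F j' = {})"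
proof -
  from F obtain F where F: "\<And>k j i. j < r \<Longrightarrow> \<bar>i\<bar> \<le> int k \<Longrightarrow> parsed_at W v (F k j) i"
    and dis: "\<And>k j j'. j < r \<Longrightarrow> j' < r \<Longrightarrow> j \<noteq> j' \<Longrightarrow> F k j \<inter> F k j' \<inter> {- int k..int k} = {}"
    by metis
  define f where "f k i = {j. j < r \<and> i \<in> F k j}" for k i
  obtain g where g: "\<And>m. infinite {k. \<forall>i. \<bar>i\<bar> \<le> int m \<longrightarrow> f k i = g i}"
    by (rule konig_int[of "Pow {..<r}" f]) (auto simp: f_def)
  have gk: "\<exists>k\<ge>n. \<forall>i. \<bar>i\<bar> \<le> int n \<longrightarrow> f k i = g i" for n
    using g[of n] unfolding infinite_nat_iff_unbounded_le by blast
  define G where "G j = {i. j \<in> g i}" for j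
  have GF: "i \<in> G j \<longleftrightarrow> i \<in> F k j" if "f k i = g i" "j < r" for i j k
    using that by (auto simp: f_def G_def)
  show ?thesis
  proof (intro exI[of _ G] conjI allI impI)
    fix j assume j: "j < r"
    show "parse W v (G j)"
      unfolding parse_def
    proof
      fix i
      \<comment> \<open>The margin \<open>m\<close> makes the parse at \<open>i\<close> depend only
        on coordinates where \<open>f k\<close> equals \<open>g\<close>.\<close>
      obtain k where k: "k \<ge> nat \<bar>i\<bar> + m" "\<And>i'. \<bar>i'\<bar> \<le> int (nat \<bar>i\<bar> + m) \<Longrightarrow> f k i' = g i'"
        using gk by blast
      have "parsed_at W v (F k j) i" using F[OF j] k(1) by simp
      then show "parsed_at W v (G j) i"
        by (rule parsed_at_cong[OF _ len]) (use GF[OF k(2) j] in auto)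
    qed
  next
    fix j j' assume j: "j < r" "j' < r" "j \<noteq> j'"
    show "G j \<inter> G j' = {}"
    proof (rule ccontr)
      assume "G j \<inter> G j' \<noteq> {}"
      then obtain i where i: "i \<in> G j" "i \<in> G j'" by blast
      obtain k where k: "k \<ge> nat \<bar>i\<bar>" "\<And>i'. \<bar>i'\<bar> \<le> int (nat \<bar>i\<bar>) \<Longrightarrow> f k i' = g i'"
        using gk by blast
      have "i \<in> F k j \<inter> F k j' \<inter> {- int k..int k}"
        using i GF[OF k(2)] j k(1) by auto
      then show False using dis[OF j] by blast
    qed
  qed
qed

text \<open>The word covering 0 starts in \<open>{- int m..0}\<close>; disjoint parses have
  different such starts, and there are \<open>Suc m\<close> places.\<close>

lemma disjoint_parses_bound:
  fixes r :: nat
  assumes len: "\<And>w. w \<in> W \<Longrightarrow> length w \<le> m"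
    and par: "\<And>j. j < r \<Longrightarrow> parse W v (F j)"
    and dis: "\<And>j j'. j < r \<Longrightarrow> j' < r \<Longrightarrow> j \<noteq> j' \<Longrightarrow> F j \<inter> F j' = {}"
  shows "r \<le> Suc m"
proof -
  have "\<exists>c\<in>{- int m..0}. c \<in> F j" if j: "j < r" for j
  proof -
    obtain c w where "word_at W v (F j) c w" "c \<le> 0" "0 < c + int (length w)"
      using par[OF j] unfolding parse_def parsed_at_def by blast
    moreover then have "length w \<le> m" "c \<in> F j" using len by (auto simp: word_at_def)
    ultimately show ?thesis by force
  qed
  then obtain c where c: "\<And>j. j < r \<Longrightarrow> c j \<in> {- int m..0} \<and> c j \<in> F j" by metis
  have "inj_on c {..<r}" using c dis by (intro inj_onI) (metis IntI empty_iff lessThan_iff)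
  then have "card {..<r} \<le> card {- int m..0}"
    by (rule card_inj_on_le) (use c in auto)
  then show ?thesis by simp
qed

section \<open>Special words of concatenations\<close>

text \<open>A state \<open>(v, w, i)\<close> of a leftward reader: the last \<open>i\<close> letters of the word \<open>w\<close> have been read,
  and \<open>w\<close> is followed by \<open>v\<close>.\<close>

definition states :: "'a list set \<Rightarrow> ('a list \<times> 'a list \<times> nat) set" where
  "states W = {(v, w, i). v \<in> W \<and> w \<in> W \<and> 1 \<le> i \<and> i \<le> length w}"

text \<open>An edge of the first kind reads the next letter of the same word; one of the second kind
  enters the preceding word \<open>u\<close>, forgets \<open>v\<close> and remembers
  \<open>w\<close> instead. Each vertex has at most one outgoing edge of the first kind; those of
  the second kind account for \<open>card W ^ 3\<close>.\<close>

definition moves :: "'a list set \<Rightarrow> (('a list \<times> 'a list \<times> nat) \<times> 'a \<times> ('a list \<times> 'a list \<times> nat)) set" where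
  "moves W =
     (\<lambda>(v, w, i). ((v, w, i), w ! (length w - Suc i), (v, w, Suc i))) `
        {(v, w, i). (v, w, i) \<in> states W \<and> i < length w} \<union>
     (\<lambda>(u, v, w). ((v, w, length w), last u, (w, u, 1))) ` (W \<times> W \<times> W)"

text \<open>The \<open>l\<close> letters to the right of the reader, all inside \<open>w\<close> and
  \<open>v\<close> once every word of \<open>W\<close> has length at least \<open>l\<close>. It is
  the invariant that folding preserves.\<close>

definition context_right :: "nat \<Rightarrow> ('a list \<times> 'a list \<times> nat) \<Rightarrow> 'a list" where
  "context_right l = (\<lambda>(v, w, i). take l (drop (length w - i) w @ v))"

text \<open>The reader stands at \<open>t\<close>, so \<open>w\<close> ends and \<open>v\<close>
  begins at the cut \<open>t + int i\<close>.\<close>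

definition in_state :: "'a list set \<Rightarrow> (int \<Rightarrow> 'a) \<Rightarrow> int set \<Rightarrow> int \<Rightarrow> ('a list \<times> 'a list \<times> nat) \<Rightarrow> bool" where
  "in_state W x C t = (\<lambda>(v, w, i). 1 \<le> i \<and> i \<le> length w \<and>
     word_at W x C (t + int i - int (length w)) w \<and> word_at W x C (t + int i) v)"

lemma finite_states: "finite W \<Longrightarrow> finite (states W)"
proof -
  assume W: "finite W"
  have "states W \<subseteq> W \<times> W \<times> (\<Union>w\<in>W. {..length w})" by (auto simp: states_def)
  then show ?thesis by (rule finite_subset) (use W in auto)
qed

lemma card_moves:
  assumes "finite W"
  shows "finite (moves W)" "card (moves W) \<le> card (states W) + card W ^ 3"
proof -
  let ?S = "{(v, w, i). (v, w, i) \<in> states W \<and> i < length w}"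
  have S: "?S \<subseteq> states W" by auto
  then have fin: "finite ?S" using finite_states[OF assms] finite_subset by blast
  then show "finite (moves W)" using assms by (simp add: moves_def)
  have fin3: "finite (W \<times> W \<times> W)" using assms by simp
  have "card (moves W) \<le> card ?S + card (W \<times> W \<times> W)"
    unfolding moves_def
    by (rule order.trans[OF card_Un_le add_mono[OF card_image_le[OF fin] card_image_le[OF fin3]]])
  moreover have "card ?S \<le> card (states W)"
    by (rule card_mono[OF finite_states[OF assms] S])
  moreover have "card (W \<times> W \<times> W) = card W ^ 3"
    by (simp add: card_cartesian_product power3_eq_cube)
  ultimately show "card (moves W) \<le> card (states W) + card W ^ 3" by simp
qed

lemma moves_states:
  assumes "[] \<notin> W"
  shows "moves W \<subseteq> states W \<times> UNIV \<times> states W"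
proof -
  have "1 \<le> length w" if "w \<in> W" for w
    using assms that by (cases w) auto
  then show ?thesis by (auto simp: moves_def states_def)
qed

text \<open>No vertex is a dead end, which lets the edge count pay for one edge at every vertex. At
  the start of a word every \<open>u\<close> in \<open>W\<close> may precede; \<open>v\<close>
  serves.\<close>

lemma ex_move:
  assumes "s \<in> states W"
  shows "\<exists>a t. (s, a, t) \<in> moves W"
proof -
  obtain v w i where s: "s = (v, w, i)" "v \<in> W" "w \<in> W" "1 \<le> i" "i \<le> length w"
    using assms by (auto simp: states_def)
  show ?thesis
  proof (cases "i < length w")
    case True
    then show ?thesis using assms s unfolding moves_def by (intro exI UnI1 image_eqI[of _ _ "(v, w, i)"]) auto
  next
    case False
    then show ?thesis using s unfolding moves_def by (intro exI UnI2 image_eqI[of _ _ "(v, v, w)"]) auto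
  qed
qed

text \<open>Reading leftwards puts the new letter in front of the context. A change of word forgets
  \<open>v\<close>, but then \<open>w\<close> alone supplies \<open>l\<close> letters.\<close>

lemma context_right_move:
  assumes st: "(s, a, t) \<in> moves W" and l: "\<And>w. w \<in> W \<Longrightarrow> l \<le> length w" and ne: "[] \<notin> W"
  shows "context_right l t = take l (a # context_right l s)"
proof -
  from st consider (1) v w i where "s = (v, w, i)" "a = w ! (length w - Suc i)" "t = (v, w, Suc i)"
      "(v, w, i) \<in> states W" "i < length w"
    | (2) u v w where "s = (v, w, length w)" "a = last u" "t = (w, u, 1)" "u \<in> W" "v \<in> W" "w \<in> W"
    unfolding moves_def by auto
  then show ?thesis
  proof cases
    case 1
    then have "drop (length w - Suc i) w = w ! (length w - Suc i) # drop (length w - i) w"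
      using Cons_nth_drop_Suc[of "length w - Suc i" w] by (simp add: Suc_diff_Suc)
    then show ?thesis using 1 by (cases l) (auto simp: context_right_def min_def)
  next
    case 2
    have "u \<noteq> []" using 2 ne by blast
    then have "drop (length u - 1) u = [last u]"
      by (metis append_butlast_last_id append_eq_conv_conj length_butlast)
    moreover obtain n where "length u = Suc n" using \<open>u \<noteq> []\<close> by (cases u) auto
    moreover have "l \<le> length w" using l 2 by blast
    ultimately show ?thesis using 2 by (cases l) (simp_all add: context_right_def)
  qed
qed

text \<open>Inside a word one more letter of it is read; with \<open>w\<close> exhausted,
  \<open>t\<close> is a cut and the word ending there comes next.\<close>

lemma in_state_move:
  assumes s: "in_state W x C t s" and C: "parse W x C" and ne: "[] \<notin> W"
  shows "\<exists>s'. (s, x (t - 1), s') \<in> moves W \<and> in_state W x C (t - 1) s'"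
proof -
  obtain v w i where vw: "s = (v, w, i)" "1 \<le> i" "i \<le> length w"
      "word_at W x C (t + int i - int (length w)) w" "word_at W x C (t + int i) v"
    using s by (auto simp: in_state_def)
  then have W: "v \<in> W" "w \<in> W" by (auto simp: word_at_def)
  show ?thesis
  proof (cases "i < length w")
    case True
    have "x (t + int i - int (length w) + int (length w - Suc i)) = w ! (length w - Suc i)"
      using vw True unfolding word_at_def by (metis diff_Suc_less zero_less_Suc less_le_trans less_nat_zero_code linorder_neqE_nat)
    then have "x (t - 1) = w ! (length w - Suc i)" using True by (simp add: of_nat_diff algebra_simps)
    then have "(s, x (t - 1), (v, w, Suc i)) \<in> moves W"
      using vw W True unfolding moves_def
      by (intro UnI1 image_eqI[of _ _ "(v, w, i)"]) (auto simp: states_def)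
    moreover have "in_state W x C (t - 1) (v, w, Suc i)"
      using vw True by (auto simp: in_state_def algebra_simps)
    ultimately show ?thesis by blast
  next
    case False
    then have i: "i = length w" using vw by simp
    then have t: "t \<in> C" using vw by (auto simp: word_at_def)
    have "parsed_at W x C (t - 1)" using C by (simp add: parse_def)
    from word_before_cut[OF this t]
    obtain u where u: "word_at W x C (t - int (length u)) u" "u \<noteq> []" by blast
    then have "x (t - int (length u) + int (length u - 1)) = u ! (length u - 1)"
      unfolding word_at_def by (metis diff_less length_greater_0_conv zero_less_one)
    then have "x (t - 1) = last u"
      using u(2) by (simp add: last_conv_nth of_nat_diff Suc_leI)
    moreover have "u \<in> W" using u by (simp add: word_at_def)
    ultimately have "(s, x (t - 1), (w, u, 1)) \<in> moves W"
      using vw W i unfolding moves_def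
      by (intro UnI2 image_eqI[of _ _ "(u, v, w)"]) auto
    moreover have "in_state W x C (t - 1) (w, u, 1)"
      using vw u i by (auto simp: in_state_def Suc_le_eq)
    ultimately show ?thesis by blast
  qed
qed

lemma context_right_in_state:
  assumes s: "in_state W x C t s" and l: "\<And>w. w \<in> W \<Longrightarrow> l \<le> length w"
  shows "context_right l s = map (\<lambda>j. x (t + int j)) [0..<l]"
proof -
  obtain v w i where vw: "s = (v, w, i)" "1 \<le> i" "i \<le> length w"
      "word_at W x C (t + int i - int (length w)) w" "word_at W x C (t + int i) v"
    using s by (auto simp: in_state_def)
  have lv: "l \<le> length v" using vw l by (auto simp: word_at_def)
  show ?thesis
  proof (rule nth_equalityI)
    show "length (context_right l s) = length (map (\<lambda>j. x (t + int j)) [0..<l])"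
      using vw lv by (simp add: context_right_def)
    fix j assume "j < length (context_right l s)"
    then have j: "j < l" by (simp add: context_right_def vw)
    show "context_right l s ! j = map (\<lambda>j. x (t + int j)) [0..<l] ! j"
    proof (cases "j < i")
      case True
      then have "length w - i + j < length w" using vw by simp
      then have "x (t + int i - int (length w) + int (length w - i + j)) = w ! (length w - i + j)"
        using vw(4) unfolding word_at_def by blast
      then have "x (t + int j) = w ! (length w - i + j)"
        using vw(3) by (simp add: of_nat_diff algebra_simps)
      then show ?thesis using True vw j by (simp add: context_right_def nth_append)
    next
      case False
      then have "j - i < length v" using j lv by simp
      then have "x (t + int i + int (j - i)) = v ! (j - i)"
        using vw(5) unfolding word_at_def by blast
      then have "x (t + int j) = v ! (j - i)"
        using False by (simp add: of_nat_diff algebra_simps)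
      then show ?thesis using False vw j by (simp add: context_right_def nth_append)
    qed
  qed
qed

text \<open>The divergence is normalised to position -1. The common cut \<open>b\<close> lets both
  readings start in the same state; \<open>common_cut\<close> supplies it for minimal
  subshifts.\<close>

definition special_words :: "'a list set \<Rightarrow> nat \<Rightarrow> 'a list set" where
  "special_words W l = {map (\<lambda>j. x (int j)) [0..<l] | x. \<exists>y C D b. x (-1) \<noteq> y (-1) \<and>
     (\<forall>i\<ge>0. x i = y i) \<and> parse W x C \<and> parse W y D \<and> 0 \<le> b \<and> b \<in> C \<and> b \<in> D}"

text \<open>Two leftward readings that start at a common cut visit identified states of the folded
  graph until they diverge, so they diverge at a branching vertex, which determines the context to
  the right. Every vertex has an outgoing edge, hence the excess of edges over vertices bounds the
  number of branching vertices; folding does not increase it and it is at most \<open>(card W)\<^sup>3\<close> before.\<close>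

lemma card_special_words:
  assumes W: "finite W" and l: "\<And>w. w \<in> W \<Longrightarrow> l \<le> length w" and ne: "[] \<notin> W"
  shows "finite (special_words W l) \<and> card (special_words W l) \<le> card W ^ 3"
proof -
  let ?V = "states W" and ?E = "moves W" and ?g = "context_right l"
  \<comment> \<open>Source context and letter determine the target context, so folding respects
    \<open>context_right l\<close>.\<close>
  have inv: "?g t = ?g t'" if "(s, a, t) \<in> ?E" "(s', a, t') \<in> ?E" "?g s = ?g s'" for s a t s' t'
    using context_right_move[OF that(1) l ne] context_right_move[OF that(2) l ne] that(3) by simp
  obtain f where f: "f ` ?V \<subseteq> ?V" "\<And>v. v \<in> ?V \<Longrightarrow> ?g (f v) = ?g v"
    "\<And>s a t s' t'. (s, a, t) \<in> ?E \<Longrightarrow> (s', a, t') \<in> ?E \<Longrightarrow> f s = f s' \<Longrightarrow> f t = f t'"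
    "card ((\<lambda>(s, a, t). (f s, a, f t)) ` ?E) + card ?V \<le> card ?E + card (f ` ?V)"
    using fold_graph[OF finite_states[OF W] card_moves(1)[OF W] moves_states[OF ne], of ?g] inv
    by metis
  define E' where "E' = (\<lambda>(s, a, t). (f s, a, f t)) ` ?E"
  have finE: "finite E'" using card_moves(1)[OF W] by (simp add: E'_def)
  define B where "B = {q \<in> f ` ?V. \<exists>a a' t t'. a \<noteq> a' \<and> (q, a, t) \<in> E' \<and> (q, a', t') \<in> E'}"
  have e1: "\<forall>q \<in> f ` ?V. \<exists>p. fst p = q \<and> p \<in> E'"
  proof
    fix q assume "q \<in> f ` ?V"
    then obtain s where s: "s \<in> ?V" "q = f s" by blast
    from ex_move[OF s(1)] obtain a t where "(s, a, t) \<in> ?E" by blast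
    then show "\<exists>p. fst p = q \<and> p \<in> E'"
      unfolding E'_def s(2) by (intro exI[of _ "(f s, a, f t)"]) force
  qed
  \<comment> \<open>\<open>e\<close> picks an edge out of each folded vertex, and \<open>d\<close>
    below a second one out of each branching vertex. All these edges differ, so vertices plus
    branching vertices are at most the edges.\<close>
  from bchoice[OF e1] obtain e where e: "\<And>q. q \<in> f ` ?V \<Longrightarrow> fst (e q) = q \<and> e q \<in> E'" by blast
  have e2: "\<forall>q \<in> B. \<exists>p. fst p = q \<and> p \<in> E' \<and> p \<noteq> e q"
  proof
    fix q assume "q \<in> B"
    then obtain a a' t t' where "a \<noteq> a'" "(q, a, t) \<in> E'" "(q, a', t') \<in> E'"
      unfolding B_def by blast
    then show "\<exists>p. fst p = q \<and> p \<in> E' \<and> p \<noteq> e q"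
      by (metis fst_conv prod.inject)
  qed
  from bchoice[OF e2] obtain d where d: "\<And>q. q \<in> B \<Longrightarrow> fst (d q) = q \<and> d q \<in> E' \<and> d q \<noteq> e q" by blast
  have finV: "finite (f ` ?V)" using finite_states[OF W] by simp
  have finB: "finite B" using finV by (auto simp: B_def)
  have "inj_on e (f ` ?V)" by (rule inj_onI) (use e in metis)
  moreover have "inj_on d B" by (rule inj_onI) (use d in metis)
  ultimately have "card (f ` ?V) + card B = card (e ` f ` ?V) + card (d ` B)"
    by (simp add: card_image)
  also have "\<dots> = card (e ` f ` ?V \<union> d ` B)"
  proof (rule card_Un_disjoint[symmetric])
    show "e ` f ` ?V \<inter> d ` B = {}"
    proof (rule ccontr)
      assume "e ` f ` ?V \<inter> d ` B \<noteq> {}"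
      then obtain p q where "p \<in> f ` ?V" "q \<in> B" "e p = d q" by blast
      then show False using e[of p] d[of q] by auto
    qed
  qed (use finV finB in auto)
  also have "\<dots> \<le> card E'"
    by (rule card_mono[OF finE]) (use e d in blast)
  finally have cB: "card B \<le> card W ^ 3"
    using f(4) card_moves(2)[OF W] unfolding E'_def by linarith
  have "special_words W l \<subseteq> ?g ` B"
  proof
    fix u assume "u \<in> special_words W l"
    then obtain x y C D b where u: "u = map (\<lambda>j. x (int j)) [0..<l]" and xy: "x (-1) \<noteq> y (-1)"
      "\<And>i. 0 \<le> i \<Longrightarrow> x i = y i" "parse W x C" "parse W y D" "0 \<le> b" "b \<in> C" "b \<in> D"
      unfolding special_words_def by blast
    \<comment> \<open>Regluing makes the two parses equal from \<open>b\<close> on, so both readings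
      start at \<open>b\<close> in the same state.\<close>
    define D' where "D' = D \<inter> {..b} \<union> C \<inter> {b..}"
    have D': "parse W y D'"
      unfolding D'_def by (rule parse_glue[OF xy(3,4,6,7)]) (use xy in auto)
    obtain w where w: "word_at W x C b w" "w \<noteq> []"
      using word_at_cut[of W x C b] xy unfolding parse_def by blast
    then have "b + int (length w) \<in> C" by (simp add: word_at_def)
    then obtain v where v: "word_at W x C (b + int (length w)) v"
      using word_at_cut[of W x C] xy unfolding parse_def by blast
    have glue: "word_at W y D' c z" if "word_at W x C c z" "b \<le> c" for c z
    proof -
      have "i \<in> D' \<longleftrightarrow> i \<in> C" if "b \<le> i" for i
        using that xy by (cases "i = b") (auto simp: D'_def)
      then show ?thesis
        using that xy by (subst word_at_cong[of _ _ _ C _ x]) auto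
    qed
    have sx: "in_state W x C b (v, w, length w)"
      using w v by (auto simp: in_state_def Suc_le_eq)
    have sy: "in_state W y D' b (v, w, length w)"
      using w v by (auto simp: in_state_def Suc_le_eq intro: glue)
    \<comment> \<open>While \<open>x\<close> and \<open>y\<close> show the same letter, determinism
      of the folded graph keeps the two states identified.\<close>
    have "\<exists>s s'. in_state W x C (b - int n) s \<and> in_state W y D' (b - int n) s' \<and> f s = f s'"
      if "int n \<le> b" for n
      using that
    proof (induction n)
      case 0
      show ?case by (rule exI[of _ "(v, w, length w)"], rule exI[of _ "(v, w, length w)"]) (use sx sy in simp)
    next
      case (Suc n)
      then obtain s s' where s: "in_state W x C (b - int n) s" "in_state W y D' (b - int n) s'" "f s = f s'"
        by auto
      obtain t where t: "(s, x (b - int n - 1), t) \<in> ?E" "in_state W x C (b - int n - 1) t"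
        using in_state_move[OF s(1) xy(3) ne] by blast
      obtain t' where t': "(s', y (b - int n - 1), t') \<in> ?E" "in_state W y D' (b - int n - 1) t'"
        using in_state_move[OF s(2) D' ne] by blast
      have "x (b - int n - 1) = y (b - int n - 1)" using xy(2) Suc.prems by simp
      then have "f t = f t'" using f(3) t t' s(3) by metis
      moreover have "b - int n - 1 = b - int (Suc n)" by simp
      ultimately show ?case using t t' by metis
    qed
    from this[of "nat b"] obtain s s' where s: "in_state W x C 0 s" "in_state W y D' 0 s'" "f s = f s'"
      using xy(5) by auto
    obtain t where t: "(s, x (-1), t) \<in> ?E" using in_state_move[OF s(1) xy(3) ne] by auto
    obtain t' where t': "(s', y (-1), t') \<in> ?E" using in_state_move[OF s(2) D' ne] by auto
    have sV: "s \<in> ?V" using t moves_states[OF ne] by blast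
    have "(f s, x (-1), f t) \<in> E'" "(f s, y (-1), f t') \<in> E'"
      using t t' s(3) unfolding E'_def by force+
    then have "f s \<in> B" using sV xy(1) unfolding B_def by blast
    moreover have "u = ?g (f s)"
      using context_right_in_state[OF s(1) l] f(2)[OF sV] u by simp
    ultimately show "u \<in> ?g ` B" by blast
  qed
  then show ?thesis
    using finB cB by (meson card_image_le card_mono finite_imageI finite_subset le_trans)
qed

section \<open>Asymptotic pairs in minimal subshifts\<close>

text \<open>Closedness and density of orbits are expressed by agreement on central windows, which
  frees the combinatorial arguments from the topology.\<close>

locale minimal_subshift =
  fixes X :: "(int \<Rightarrow> 'a) set" and B :: "'a set"
  assumes finite_alphabet: "finite B"
    and letters: "x \<in> X \<Longrightarrow> x i \<in> B"
    and closed: "(\<And>k::nat. \<exists>x\<in>X. \<forall>i. \<bar>i\<bar> \<le> int k \<longrightarrow> x i = v i) \<Longrightarrow> v \<in> X"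
    and translate: "x \<in> X \<Longrightarrow> (\<lambda>i. x (i + n)) \<in> X"
    and dense_orbit: "x \<in> X \<Longrightarrow> u \<in> X \<Longrightarrow> \<exists>n. \<forall>i. \<bar>i\<bar> \<le> int k \<longrightarrow> x (i + n) = u i"
begin

lemma limit_in_X:
  assumes x: "\<And>k. x k \<in> X"
    and v: "\<And>m. infinite {k. \<forall>i. \<bar>i\<bar> \<le> int m \<longrightarrow> x k i = v i}"
  shows "v \<in> X"
proof (rule closed)
  fix m
  from v[of m] obtain k where "\<forall>i. \<bar>i\<bar> \<le> int m \<longrightarrow> x k i = v i"
    using infinite_imp_nonempty by blast
  then show "\<exists>x\<in>X. \<forall>i. \<bar>i\<bar> \<le> int m \<longrightarrow> x i = v i" using x by blast
qed

text \<open>\<open>dense_orbit\<close> gives times of either sign. The orbit of a limit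
  \<open>u\<close> of forward translates of \<open>x\<close> comes near \<open>v\<close>, and
  \<open>x\<close> imitates any stretch of \<open>u\<close> arbitrarily far to the right.\<close>

lemma forward_recurrence:
  assumes x: "x \<in> X" and v: "v \<in> X"
  shows "\<exists>n\<ge>N. \<forall>i. \<bar>i\<bar> \<le> int k \<longrightarrow> x (i + n) = v i"
proof -
  obtain u where u: "\<And>m. infinite {n. \<forall>i. \<bar>i\<bar> \<le> int m \<longrightarrow> x (i + int n) = u i}"
    by (rule konig_int[of B "\<lambda>n i. x (i + int n)"]) (use finite_alphabet letters[OF x] in auto)
  have "u \<in> X" by (rule limit_in_X[of "\<lambda>n i. x (i + int n)"]) (use translate[OF x] u in auto)
  from dense_orbit[OF this v, of k]
  obtain n0 where n0: "\<And>i. \<bar>i\<bar> \<le> int k \<Longrightarrow> u (i + n0) = v i" by blast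
  obtain n where n: "n \<ge> nat (N - n0)" "\<And>i. \<bar>i\<bar> \<le> int (k + nat \<bar>n0\<bar>) \<Longrightarrow> x (i + int n) = u i"
    using u[of "k + nat \<bar>n0\<bar>"] unfolding infinite_nat_iff_unbounded_le by blast
  have "x (i + (n0 + int n)) = v i" if i: "\<bar>i\<bar> \<le> int k" for i
  proof -
    have "x (i + n0 + int n) = u (i + n0)" using i by (intro n(2)) auto
    then show ?thesis using n0[OF i] by (simp add: add.assoc)
  qed
  then show ?thesis using n(1) by (intro exI[of _ "n0 + int n"]) auto
qed

text \<open>A translate of \<open>u\<close> agrees with \<open>v\<close> on a large window, so the
  translated cut sets parse \<open>v\<close> there; compactness does the rest.\<close>

lemma disjoint_parses_transfer:
  fixes r :: nat
  assumes len: "\<And>w. w \<in> W \<Longrightarrow> length w \<le> m" and u: "u \<in> X" and v: "v \<in> X"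
    and par: "\<And>j. j < r \<Longrightarrow> parse W u (F j)"
    and dis: "\<And>j j'. j < r \<Longrightarrow> j' < r \<Longrightarrow> j \<noteq> j' \<Longrightarrow> F j \<inter> F j' = {}"
  shows "\<exists>F. (\<forall>j<r. parse W v (F j)) \<and> (\<forall>j<r. \<forall>j'<r. j \<noteq> j' \<longrightarrow> F j \<inter> F j' = {})"
proof (rule disjoint_parses_limit[OF len])
  fix k
  obtain n where n: "\<And>i. \<bar>i\<bar> \<le> int (k + m) \<Longrightarrow> u (i + n) = v i"
    using dense_orbit[OF u v, of "k + m"] by blast
  show "\<exists>F. (\<forall>j<r. \<forall>i. \<bar>i\<bar> \<le> int k \<longrightarrow> parsed_at W v (F j) i) \<and>
      (\<forall>j<r. \<forall>j'<r. j \<noteq> j' \<longrightarrow> F j \<inter> F j' \<inter> {- int k..int k} = {})"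
  proof (intro exI[of _ "\<lambda>j. {i. i + n \<in> F j}"] conjI allI impI)
    fix j i assume j: "j < r" and i: "\<bar>i\<bar> \<le> int k"
    have "parsed_at W (\<lambda>i. u (i + n)) {i. i + n \<in> F j} i"
      unfolding parsed_at_shift using par[OF j] by (simp add: parse_def)
    then show "parsed_at W v {i. i + n \<in> F j} i"
      by (rule parsed_at_cong[OF _ len]) (use n i in auto)
  qed (use dis in blast)
qed

text \<open>Take the maximal number \<open>r\<close> of pairwise disjoint parses of a point; by minimality it does not
  depend on the point. If a parse of \<open>y\<close> missed \<open>r\<close> disjoint parses of \<open>x\<close> on the half line where
  \<open>x\<close> and \<open>y\<close> agree, some limit of translates would have \<open>r + 1\<close> disjoint parses.\<close>

lemma common_cut:
  assumes fin: "finite W" and W: "\<And>x. x \<in> X \<Longrightarrow> \<exists>C. parse W x C"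
    and x: "x \<in> X" and y: "y \<in> X" and xy: "\<And>i. 0 \<le> i \<Longrightarrow> x i = y i"
  shows "\<exists>C D b. parse W x C \<and> parse W y D \<and> 0 \<le> b \<and> b \<in> C \<and> b \<in> D"
proof -
  define m where "m = Max (length ` W)"
  have len: "length w \<le> m" if "w \<in> W" for w using fin that by (simp add: m_def)
  define R where "R = {r::nat. \<exists>u\<in>X. \<exists>F. (\<forall>j<r. parse W u (F j)) \<and>
    (\<forall>j<r. \<forall>j'<r. j \<noteq> j' \<longrightarrow> F j \<inter> F j' = {})}"
  have bound: "r \<le> Suc m" if r: "r \<in> R" for r
  proof -
    obtain u F where "\<And>j. j < r \<Longrightarrow> parse W u (F j)"
      "\<And>j j'. j < r \<Longrightarrow> j' < r \<Longrightarrow> j \<noteq> j' \<Longrightarrow> F j \<inter> F j' = {}"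
      using r unfolding R_def by blast
    then show ?thesis using disjoint_parses_bound[OF len, where F = F and v = u] by blast
  qed
  then have "R \<subseteq> {..Suc m}" by blast
  then have finR: "finite R" using finite_subset by blast
  \<comment> \<open>The empty family counts, so the maximum exists.\<close>
  have "0 \<in> R" using x by (auto simp: R_def)
  define r where "r = Max R"
  have rR: "r \<in> R" and max: "Suc r \<notin> R"
    using Max_in[OF finR] Max_ge[OF finR, of "Suc r"] \<open>0 \<in> R\<close> by (auto simp: r_def)
  from rR obtain u F0 where u: "u \<in> X" and F0: "\<And>j. j < r \<Longrightarrow> parse W u (F0 j)"
      "\<And>j j'. j < r \<Longrightarrow> j' < r \<Longrightarrow> j \<noteq> j' \<Longrightarrow> F0 j \<inter> F0 j' = {}"
    unfolding R_def by blast
  have "\<exists>F. (\<forall>j<r. parse W x (F j)) \<and> (\<forall>j<r. \<forall>j'<r. j \<noteq> j' \<longrightarrow> F j \<inter> F j' = {})"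
    by (rule disjoint_parses_transfer[where W = W and F = F0 and u = u and m = m]) (use len u x F0 in auto)
  then obtain F where F: "\<And>j. j < r \<Longrightarrow> parse W x (F j)"
      "\<And>j j'. j < r \<Longrightarrow> j' < r \<Longrightarrow> j \<noteq> j' \<Longrightarrow> F j \<inter> F j' = {}"
    by blast
  obtain D where D: "parse W y D" using W[OF y] by blast
  have "\<exists>j<r. \<exists>b\<ge>0. b \<in> F j \<and> b \<in> D"
  proof (rule ccontr)
    assume contr: "\<not> ?thesis"
    define F' where "F' j = (if j < r then F j else D)" for j
    have "\<exists>F. (\<forall>j<Suc r. parse W x (F j)) \<and> (\<forall>j<Suc r. \<forall>j'<Suc r. j \<noteq> j' \<longrightarrow> F j \<inter> F j' = {})"
    proof (rule disjoint_parses_limit[OF len])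
      fix k
      \<comment> \<open>A late return of \<open>x\<close> to itself: the window around
        \<open>n\<close> lies where \<open>x\<close> and \<open>y\<close> agree, so \<open>D\<close>
        parses \<open>x\<close> there, and where by \<open>contr\<close> it misses every
        \<open>F j\<close>.\<close>
      obtain n where n: "n \<ge> int (k + m)" "\<And>i. \<bar>i\<bar> \<le> int (k + m) \<Longrightarrow> x (i + n) = x i"
        using forward_recurrence[OF x x] by blast
      show "\<exists>F. (\<forall>j<Suc r. \<forall>i. \<bar>i\<bar> \<le> int k \<longrightarrow> parsed_at W x (F j) i) \<and>
          (\<forall>j<Suc r. \<forall>j'<Suc r. j \<noteq> j' \<longrightarrow> F j \<inter> F j' \<inter> {- int k..int k} = {})"
      proof (intro exI[of _ "\<lambda>j. {i. i + n \<in> F' j}"] conjI allI impI)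
        fix j i assume j: "j < Suc r" and i: "\<bar>i\<bar> \<le> int k"
        define z where "z = (if j < r then x else y)"
        have "parse W z (F' j)" using F D by (auto simp: z_def F'_def)
        then have "parsed_at W (\<lambda>i. z (i + n)) {i. i + n \<in> F' j} i"
          unfolding parsed_at_shift by (simp add: parse_def)
        then show "parsed_at W x {i. i + n \<in> F' j} i"
        proof (rule parsed_at_cong[OF _ len])
          fix t assume "\<bar>t - i\<bar> \<le> int m"
          then have t: "\<bar>t\<bar> \<le> int (k + m)" using i by auto
          then have "0 \<le> t + n" using n(1) by auto
          then show "z (t + n) = x t" using n(2)[OF t] xy[of "t + n"] by (simp add: z_def)
        qed auto
      next
        fix j j' assume j: "j < Suc r" "j' < Suc r" "j \<noteq> j'"
        show "{i. i + n \<in> F' j} \<inter> {i. i + n \<in> F' j'} \<inter> {- int k..int k} = {}"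
        proof (rule ccontr)
          assume "\<not> ?thesis"
          then obtain i where i: "i + n \<in> F' j" "i + n \<in> F' j'" "- int k \<le> i" by auto
          then have "0 \<le> i + n" using n(1) by simp
          then have nD: "i + n \<notin> D" if "a < r" "i + n \<in> F a" for a using contr that by blast
          consider "j < r" "j' < r" | "j < r" "j' = r" | "j = r" "j' < r" using j by linarith
          then show False
            by cases (use i nD[of j] nD[of j'] F(2)[of j j'] j(3) in \<open>auto simp: F'_def\<close>)
        qed
      qed
    qed
    then have "Suc r \<in> R" using x by (auto simp: R_def)
    then show False using max by blast
  qed
  then show ?thesis using F D by blast
qed

section \<open>Tails of asymptotic pairs\<close>

definition special_tails :: "(nat \<Rightarrow> 'a) set" where
  "special_tails = {\<lambda>j. x (int j) | x. x \<in> X \<and> (\<exists>y\<in>X. x (-1) \<noteq> y (-1) \<and> (\<forall>i\<ge>0. x i = y i))}"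

text \<open>Were there \<open>Suc (K ^ 3)\<close> tails, their prefixes of some length
  \<open>l\<close> would already tell them apart. These are special words of a \<open>W\<close>
  chosen for this \<open>l\<close>, and there are at most \<open>K ^ 3\<close> of them whatever
  \<open>l\<close> is.\<close>

lemma finite_special_tails:
  assumes W: "\<And>l. \<exists>W. finite W \<and> card W \<le> K \<and> (\<forall>w\<in>W. l \<le> length w) \<and> (\<forall>x\<in>X. \<exists>C. parse W x C)"
  shows "finite special_tails"
proof (rule ccontr)
  assume "infinite special_tails"
  then obtain Z where Z: "Z \<subseteq> special_tails" "finite Z" "card Z = Suc (K ^ 3)"
    using infinite_arbitrarily_large by metis
  have "\<exists>l. inj_on (\<lambda>z. map z [0..<l]) Z"
  proof -
    define d where "d z z' = (LEAST i. z i \<noteq> z' i)" for z z' :: "nat \<Rightarrow> 'a"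
    have d: "z (d z z') \<noteq> z' (d z z')" if "z \<noteq> z'" for z z' :: "nat \<Rightarrow> 'a"
    proof -
      from that obtain i where "z i \<noteq> z' i" by blast
      then show ?thesis unfolding d_def by (rule LeastI)
    qed
    define l where "l = Suc (Max (case_prod d ` (Z \<times> Z)))"
    have "d z z' < l" if "z \<in> Z" "z' \<in> Z" for z z'
    proof -
      have "d z z' \<in> case_prod d ` (Z \<times> Z)" using that by force
      then show ?thesis using Z(2) by (simp add: l_def less_Suc_eq_le)
    qed
    then have "inj_on (\<lambda>z. map z [0..<l]) Z"
      using d by (intro inj_onI) (metis atLeast0LessThan atLeast_upt lessThan_iff map_eq_conv)
    then show ?thesis by blast
  qed
  then obtain l where inj: "inj_on (\<lambda>z. map z [0..<l]) Z" by blast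
  \<comment> \<open>Length \<open>Suc l\<close> rather than \<open>l\<close> excludes the empty word
    also when \<open>l = 0\<close>.\<close>
  obtain W where W: "finite W" "card W \<le> K" "\<And>w. w \<in> W \<Longrightarrow> Suc l \<le> length w"
      "\<And>x. x \<in> X \<Longrightarrow> \<exists>C. parse W x C"
    using W[of "Suc l"] by blast
  have len: "l \<le> length w" if "w \<in> W" for w using W(3)[OF that] by simp
  have "[] \<notin> W" using W(3) by force
  note sw = card_special_words[OF W(1) len this]
  have "(\<lambda>z. map z [0..<l]) ` Z \<subseteq> special_words W l"
  proof
    fix u assume "u \<in> (\<lambda>z. map z [0..<l]) ` Z"
    then obtain z where z: "z \<in> special_tails" "u = map z [0..<l]" using Z(1) by blast
    then obtain x y where xy: "z = (\<lambda>j. x (int j))" "x \<in> X" "y \<in> X" "x (-1) \<noteq> y (-1)" "\<And>i. 0 \<le> i \<Longrightarrow> x i = y i"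
      unfolding special_tails_def by blast
    from common_cut[OF W(1,4) xy(2,3,5)]
    show "u \<in> special_words W l" using xy z(2) unfolding special_words_def by blast
  qed
  then have "card Z \<le> card (special_words W l)"
    using card_image[OF inj] sw card_mono by metis
  also have "\<dots> \<le> card W ^ 3" using sw by simp
  also have "\<dots> \<le> K ^ 3" using W(2) by (rule power_mono) simp
  finally show False using Z(3) by simp
qed

text \<open>By compactness some \<open>N\<close> letters determine the letter before them, hence the
  whole past. Repetitions among the finitely many words of length \<open>N\<close> make all points
  periodic with one common period, so \<open>N\<close> letters determine a point. The contrapositive
  yields an asymptotic pair in an infinite subshift.\<close>

lemma finite_if_left_deterministic:
  assumes det: "\<And>x y. x \<in> X \<Longrightarrow> y \<in> X \<Longrightarrow> (\<forall>i\<ge>0. x i = y i) \<Longrightarrow> x (-1) = y (-1)"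
  shows "finite X"
proof -
  have "\<exists>N. \<forall>x\<in>X. \<forall>y\<in>X. (\<forall>i. 0 \<le> i \<and> i < int N \<longrightarrow> x i = y i) \<longrightarrow> x (-1) = y (-1)"
  proof (rule ccontr)
    assume "\<not> ?thesis"
    then have "\<forall>N. \<exists>x y. x \<in> X \<and> y \<in> X \<and> (\<forall>i. 0 \<le> i \<and> i < int N \<longrightarrow> x i = y i) \<and> x (-1) \<noteq> y (-1)"
      by blast
    then obtain x y where xy: "\<And>N. x N \<in> X" "\<And>N. y N \<in> X"
        "\<And>N i. 0 \<le> i \<Longrightarrow> i < int N \<Longrightarrow> x N i = y N i" "\<And>N. x N (-1) \<noteq> y N (-1)"
      by metis
    obtain g where g: "\<And>m. infinite {N. \<forall>i. \<bar>i\<bar> \<le> int m \<longrightarrow> (x N i, y N i) = g i}"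
      by (rule konig_int[of "B \<times> B" "\<lambda>N i. (x N i, y N i)"]) (use finite_alphabet letters xy in auto)
    have "infinite {N. \<forall>i. \<bar>i\<bar> \<le> int m \<longrightarrow> x N i = fst (g i)}" for m
      by (rule infinite_super[OF _ g[of m]]) (auto simp: prod_eq_iff)
    moreover have "infinite {N. \<forall>i. \<bar>i\<bar> \<le> int m \<longrightarrow> y N i = snd (g i)}" for m
      by (rule infinite_super[OF _ g[of m]]) (auto simp: prod_eq_iff)
    ultimately have X: "(\<lambda>i. fst (g i)) \<in> X" "(\<lambda>i. snd (g i)) \<in> X"
      using limit_in_X[of x "\<lambda>i. fst (g i)"] limit_in_X[of y "\<lambda>i. snd (g i)"] xy by auto
    have gN: "\<exists>N\<ge>n. \<forall>i. \<bar>i\<bar> \<le> int m \<longrightarrow> (x N i, y N i) = g i" for n m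
      using g[of m] unfolding infinite_nat_iff_unbounded_le by blast
    have "fst (g i) = snd (g i)" if "0 \<le> i" for i
    proof -
      obtain N where "N \<ge> Suc (nat i)" "\<forall>j. \<bar>j\<bar> \<le> int (nat i) \<longrightarrow> (x N j, y N j) = g j"
        using gN by blast
      moreover from this have "(x N i, y N i) = g i" using that by simp
      ultimately show ?thesis using xy(3)[OF that, of N] that by (metis fst_conv nat_less_iff snd_conv Suc_le_eq)
    qed
    then have "fst (g (-1)) = snd (g (-1))" using det[OF X] by blast
    moreover obtain M where "\<forall>j. \<bar>j\<bar> \<le> int 1 \<longrightarrow> (x M j, y M j) = g j"
      using gN by blast
    moreover from this have "(x M (-1), y M (-1)) = g (-1)" by simp
    ultimately show False using xy(4)[of M] by (metis fst_conv snd_conv)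
  qed
  then obtain N where N: "\<And>x y. x \<in> X \<Longrightarrow> y \<in> X \<Longrightarrow> (\<And>i. 0 \<le> i \<Longrightarrow> i < int N \<Longrightarrow> x i = y i) \<Longrightarrow> x (-1) = y (-1)"
    by blast
  have past: "x i = y i"
    if "x \<in> X" "y \<in> X" "\<And>i. 0 \<le> i \<Longrightarrow> i < int N \<Longrightarrow> x i = y i" "i < int N" for x y i
  proof -
    have "\<forall>i. - int n \<le> i \<and> i < int N \<longrightarrow> x i = y i" for n
    proof (induction n)
      case (Suc n)
      have "(\<lambda>i. x (i + - int n)) (-1) = (\<lambda>i. y (i + - int n)) (-1)"
        by (rule N[OF translate translate]) (use that Suc in auto)
      then have "x (- int (Suc n)) = y (- int (Suc n))" by (simp add: algebra_simps)
      moreover have "i = - int (Suc n) \<or> - int n \<le> i" if "- int (Suc n) \<le> i" for i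
        using that by auto
      ultimately show ?case using Suc by blast
    qed (use that(3) in auto)
    from this[of "nat \<bar>i\<bar>"] show ?thesis using that(4) by auto
  qed
  define word where "word x = map (\<lambda>j. x (int j)) [0..<N]" for x :: "int \<Rightarrow> 'a"
  have word_eq: "x i = y i" if "word x = word y" "0 \<le> i" "i < int N" for x y i
  proof -
    have "nat i \<in> set [0..<N]" using that by auto
    with that(1) have "x (int (nat i)) = y (int (nat i))" unfolding word_def by (metis map_eq_conv)
    then show ?thesis using that by simp
  qed
  define P where "P = {xs. set xs \<subseteq> B \<and> length xs = N}"
  have finP: "finite P" unfolding P_def by (rule finite_lists_length_eq[OF finite_alphabet])
  have wordP: "word x \<in> P" if "x \<in> X" for x
    using letters[OF that] by (auto simp: word_def P_def)
  define q where "q = card P"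
  have periodic: "x (i + int (fact q)) = x i" if x: "x \<in> X" for x i
  proof -
    \<comment> \<open>Among the \<open>q + 1\<close> words starting at \<open>n\<close>, ...,
      \<open>n + q\<close> two coincide, and their common past gives a period \<open>d\<close> valid
      left of \<open>n\<close>. One \<open>d\<close> occurs for infinitely many \<open>n\<close>, so
      it is a period of all of \<open>x\<close>.\<close>
    have "\<exists>d\<in>{1..q}. \<forall>i<int n. x i = x (i + int d)" for n
    proof -
      have "\<not> inj_on (\<lambda>a. word (\<lambda>i. x (i + int (n + a)))) {..q}"
      proof
        assume "inj_on (\<lambda>a. word (\<lambda>i. x (i + int (n + a)))) {..q}"
        then have "card {..q} \<le> card P"
          by (rule card_inj_on_le) (use finP wordP translate[OF x] in auto)
        then show False by (simp add: q_def)
      qed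
      then obtain a b where ab: "a < b" "b \<le> q"
          "word (\<lambda>i. x (i + int (n + a))) = word (\<lambda>i. x (i + int (n + b)))"
        unfolding inj_on_def by (metis atMost_iff linorder_neqE_nat)
      have "x i = x (i + int (b - a))" if "i < int n" for i
      proof -
        have "(\<lambda>i. x (i + int (n + a))) (i - int (n + a)) = (\<lambda>i. x (i + int (n + b))) (i - int (n + a))"
          by (rule past[OF translate translate]) (use x word_eq[OF ab(3)] that in auto)
        then show ?thesis using ab(1) by (simp add: of_nat_diff algebra_simps)
      qed
      then show ?thesis using ab by (intro bexI[of _ "b - a"]) auto
    qed
    then obtain d where d: "\<And>n. d n \<in> {1..q}" "\<And>n i. i < int n \<Longrightarrow> x i = x (i + int (d n))"
      by metis
    have "\<exists>e\<in>{1..q}. infinite {n. d n = e}"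
      using pigeonhole_infinite_rel[of UNIV "{1..q}" "\<lambda>n e. d n = e"] d(1) by auto
    then obtain e where e: "e \<in> {1..q}" "infinite {n. d n = e}" by blast
    have step: "x (i + int e) = x i" for i
    proof -
      obtain n where "n \<ge> Suc (nat \<bar>i\<bar>)" "d n = e"
        using e(2) unfolding infinite_nat_iff_unbounded_le by blast
      then show ?thesis using d(2)[of i n] by auto
    qed
    have "x (i + int (e * k)) = x i" for k
    proof (induction k)
      case (Suc k)
      then show ?case using step[of "i + int (e * k)"] by (simp add: algebra_simps)
    qed simp
    \<comment> \<open>\<open>fact q\<close> is a multiple of every possible \<open>e\<close>, hence
      a period common to all points.\<close>
    moreover have "e dvd fact q" using e(1) by (intro dvd_fact) auto
    ultimately show ?thesis by (metis dvdE)
  qed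
  have per: "x i = x (i - int (fact q * k))" if "x \<in> X" for x i k
  proof (induction k)
    case (Suc k)
    have "x (i - int (fact q * Suc k) + int (fact q)) = x (i - int (fact q * Suc k))"
      by (rule periodic[OF that])
    then show ?case using Suc by (simp add: algebra_simps)
  qed simp
  have "inj_on word X"
  proof (rule inj_onI, rule ext)
    fix x y i assume xy: "x \<in> X" "y \<in> X" "word x = word y"
    \<comment> \<open>A multiple of the common period moves \<open>i\<close> to the left of 0, where
      the \<open>N\<close> letters determine everything.\<close>
    define j where "j = i - int (fact q * nat (\<bar>i\<bar> + 1))"
    have "int (nat (\<bar>i\<bar> + 1)) \<le> int (fact q * nat (\<bar>i\<bar> + 1))"
      using fact_ge_1[of q] by (simp only: of_nat_le_iff) simp
    then have "j < int N" unfolding j_def by linarith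
    then have "x j = y j" using past[OF xy(1,2)] word_eq[OF xy(3)] by blast
    then show "x i = y i" using per[OF xy(1)] per[OF xy(2)] unfolding j_def by metis
  qed
  then show "finite X" by (rule inj_on_finite[OF _ _ finP]) (use wordP in auto)
qed

end

section \<open>Parsing the S-adic subshift\<close>

lemma semigroup_morphism_comp:
  "semigroup_morphism A B f \<Longrightarrow> semigroup_morphism B C g \<Longrightarrow> semigroup_morphism A C (g \<circ> f)"
  unfolding semigroup_morphism_def by simp

lemma semigroup_morphism_concat:
  assumes f: "semigroup_morphism A B f" and w: "w \<in> words A"
  shows "f w = concat (map (\<lambda>a. f [a]) w)"
proof -
  have "w \<noteq> []" "w \<in> lists A" using w by (auto simp: words_def)
  then show ?thesis
  proof (induction w rule: list_nonempty_induct)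
    case (cons a w)
    then have "[a] \<in> words A" "w \<in> words A" by (auto simp: words_def)
    then have "f ([a] @ w) = f [a] @ f w" using f unfolding semigroup_morphism_def by blast
    then show ?case using cons by simp
  qed simp
qed

lemma compose_range_split:
  assumes "n \<le> m" "m \<le> N"
  shows "compose_range \<tau> n N = compose_range \<tau> n m \<circ> compose_range \<tau> m N"
proof -
  have comp: "foldr (\<circ>) fs g = foldr (\<circ>) fs id \<circ> g" for fs :: "('x \<Rightarrow> 'x) list" and g
    by (induction fs) (auto simp: fun_eq_iff)
  have "[n..<N] = [n..<m] @ [m..<N]" using assms by (metis le_add_diff_inverse upt_add_eq_append)
  then show ?thesis unfolding compose_range_def by (simp add: comp[of _ "foldr (\<circ>) (map \<tau> [m..<N]) id"])
qed

lemma semigroup_morphism_compose_range: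
  assumes "directive_sequence A \<tau>" "n \<le> N"
  shows "semigroup_morphism (A N) (A n) (compose_range \<tau> n N)"
  using assms(2)
proof (induction N rule: dec_induct)
  case base
  then show ?case by (simp add: compose_range_def semigroup_morphism_def)
next
  case (step N)
  have "compose_range \<tau> N (Suc N) = \<tau> N" by (simp add: compose_range_def)
  then have "compose_range \<tau> n (Suc N) = compose_range \<tau> n N \<circ> \<tau> N"
    using compose_range_split[of n N "Suc N" \<tau>] step.hyps by simp
  moreover have "semigroup_morphism (A (Suc N)) (A N) (\<tau> N)"
    using assms(1) by (simp add: directive_sequence_def)
  ultimately show ?case using semigroup_morphism_comp step.IH by metis
qed

section \<open>Cutting points into images of letters\<close>

definition level_words :: "(nat \<Rightarrow> 'a set) \<Rightarrow> (nat \<Rightarrow> 'a list \<Rightarrow> 'a list) \<Rightarrow> nat \<Rightarrow> 'a list set" where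
  "level_words A \<tau> n = (\<lambda>a. compose_range \<tau> 0 n [a]) ` A n"

text \<open>\<open>C\<close> consists of the word boundaries of \<open>ws\<close>, placed so that
  \<open>p\<close> ends just before \<open>s\<close>. The margin \<open>m\<close> keeps the word
  covering \<open>i\<close> inside the window from \<open>s\<close> to \<open>t\<close>, where
  \<open>x\<close> is known to match.\<close>

lemma parsed_at_concat:
  assumes ws: "set ws \<subseteq> W" "[] \<notin> W"
    and x: "concat ws = p @ map x [s..t] @ q"
    and m: "\<And>w. w \<in> W \<Longrightarrow> length w \<le> m"
  defines "C \<equiv> {s - int (length p) + int (length (concat (take j ws))) | j. j \<le> length ws}"
  assumes i: "s + int m \<le> i" "i + int m \<le> t"
  shows "parsed_at W x C i"
proof -
  define off where "off = s - int (length p)"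
  define P where "P j = length (concat (take j ws))" for j
  have P0: "P 0 = 0" and PS: "j < length ws \<Longrightarrow> P (Suc j) = P j + length (ws ! j)" for j
    by (auto simp: P_def take_Suc_conv_app_nth)
  have PN: "P (length ws) = length p + nat (t - s + 1) + length q"
    unfolding P_def using arg_cong[OF x, of length] by simp
  have mono: "P j \<le> P j'" if "j \<le> j'" for j j'
  proof -
    have "take j' ws = take j ws @ take (j' - j) (drop j ws)" using that by (metis le_add_diff_inverse take_add)
    then show ?thesis by (simp add: P_def)
  qed
  have C: "C = {off + int (P j) | j. j \<le> length ws}" by (simp add: C_def off_def P_def)
  define n where "n = nat (i - off)"
  have n: "int n = i - off" using i by (simp add: n_def off_def)
  have "n < P (length ws)" using i n PN by (simp add: off_def)
  define j where "j = (LEAST j. n < P (Suc j))"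
  have ex: "\<exists>j. n < P (Suc j)"
    using \<open>n < P (length ws)\<close> P0 by (metis not_less0 old.nat.exhaust)
  have j1: "n < P (Suc j)" unfolding j_def by (rule LeastI_ex[OF ex])
  have j0: "P j \<le> n"
  proof (cases j)
    case (Suc j')
    then have "\<not> n < P (Suc j')" using not_less_Least[of j' "\<lambda>j. n < P (Suc j)"] by (simp add: j_def)
    then show ?thesis using Suc by simp
  qed (simp add: P0)
  have jl: "j < length ws"
  proof (rule ccontr)
    assume "\<not> ?thesis"
    then have "P (length ws) \<le> P j" by (intro mono) simp
    then show False using j0 \<open>n < P (length ws)\<close> by simp
  qed
  define w where "w = ws ! j"
  have wW: "w \<in> W" using jl ws by (auto simp: w_def)
  define c where "c = off + int (P j)"
  have ce: "c + int (length w) = off + int (P (Suc j))" using PS[OF jl] by (simp add: c_def w_def)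
  have "word_at W x C c w"
    unfolding word_at_def
  proof (intro conjI allI impI)
    show "w \<in> W" by (rule wW)
    show "c \<in> C" using jl by (auto simp: C c_def)
    show "c + int (length w) \<in> C" unfolding ce C using jl by (auto intro!: exI[of _ "Suc j"])
    show "{c<..<c + int (length w)} \<inter> C = {}"
    proof (rule ccontr)
      assume "\<not> ?thesis"
      then obtain j' where "P j < P j'" "P j' < P (Suc j)" using ce by (auto simp: C c_def)
      moreover have "j' \<le> j \<or> Suc j \<le> j'" by auto
      ultimately show False using mono[of j' j] mono[of "Suc j" j'] by auto
    qed
    fix h assume h: "h < length w"
    have "c \<le> i" "i < c + int (length w)" using j0 j1 n ce by (auto simp: c_def)
    then have st: "s \<le> c" "c + int h \<le> t" using i m[OF wW] h by auto
    have eq: "ws = take j ws @ w # drop (Suc j) ws" using jl by (simp add: w_def id_take_nth_drop)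
    have "concat ws = concat (take j ws) @ w @ concat (drop (Suc j) ws)"
      by (subst eq) simp
    then have "concat ws ! (P j + h) = w ! h"
      using h by (simp add: nth_append P_def)
    moreover have "P j + h = length p + nat (c + int h - s)" using st by (simp add: c_def off_def)
    moreover have "nat (c + int h - s) < length (map x [s..t])" using st by simp
    ultimately have "map x [s..t] ! nat (c + int h - s) = w ! h"
      unfolding x by (simp add: nth_append)
    then show "x (c + int h) = w ! h" using st by (simp add: nth_upto)
  qed
  moreover have "c \<le> i" "i < c + int (length w)" using j0 j1 n ce by (auto simp: c_def)
  ultimately show ?thesis unfolding parsed_at_def by blast
qed

text \<open>A window of \<open>x\<close> lies in the image of a letter of some level
  \<open>N\<close>. For \<open>n \<le> N\<close> that image is a concatenation of words of level
  \<open>n\<close>, which parses the middle of the window; compactness extends this to all of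
  \<open>x\<close>.\<close>

lemma subshift_parsable:
  assumes ds: "directive_sequence A \<tau>" and x: "x \<in> subshift A \<tau>"
  shows "\<exists>C. parse (level_words A \<tau> n) x C"
proof -
  let ?W = "level_words A \<tau> n"
  have finA: "finite (A N)" for N using ds by (simp add: directive_sequence_def)
  then have "finite ?W" by (simp add: level_words_def)
  define m where "m = Max (length ` ?W)"
  have len: "length w \<le> m" if "w \<in> ?W" for w using \<open>finite ?W\<close> that by (simp add: m_def)
  have mor: "semigroup_morphism (A N) (A n') (compose_range \<tau> n' N)" if "n' \<le> N" for n' N
    by (rule semigroup_morphism_compose_range[OF ds that])
  have img: "compose_range \<tau> n' N [a] \<in> words (A n')" if "n' \<le> N" "a \<in> A N" for n' N a
    using mor[OF that(1)] that(2) by (simp add: semigroup_morphism_def words_def)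
  have ne: "[] \<notin> ?W"
  proof
    assume "[] \<in> ?W"
    then obtain a where "a \<in> A n" "compose_range \<tau> 0 n [a] = []" unfolding level_words_def by auto
    then show False using img[of 0 n a] by (simp add: words_def)
  qed
  \<comment> \<open>Images of letters of levels below \<open>n\<close> have length at most
    \<open>b\<close>, so a window longer than \<open>b\<close> forces
    \<open>n \<le> N\<close>.\<close>
  define b where "b = Max (insert 0 (\<Union>N\<in>{..<n}. (\<lambda>a. length (compose_range \<tau> 0 N [a])) ` A N))"
  have b: "length (compose_range \<tau> 0 N [a]) \<le> b" if "N < n" "a \<in> A N" for N a
    unfolding b_def by (rule Max_ge) (use finA that in auto)
  \<comment> \<open>With \<open>r = 1\<close> disjointness is void, and the family argument is plain
    compactness for one parse.\<close>
  have "\<exists>F. (\<forall>j<1::nat. parse ?W x (F j)) \<and> (\<forall>j<1. \<forall>j'<1. j \<noteq> j' \<longrightarrow> F j \<inter> F j' = {})"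
  proof (rule disjoint_parses_limit[OF len])
    fix k
    define h where "h = k + m + b"
    obtain N a where Na: "a \<in> A N" "sublist (map x [- int h..int h]) (compose_range \<tau> 0 N [a])"
      using x unfolding subshift_def by blast
    have "length (map x [- int h..int h]) \<le> length (compose_range \<tau> 0 N [a])"
      using Na(2) by (rule sublist_length_le)
    then have "n \<le> N" using b[OF _ Na(1)] by (intro leI notI) (force simp: h_def)
    define us where "us = compose_range \<tau> n N [a]"
    have us: "us \<in> words (A n)"
      unfolding us_def by (rule img[OF \<open>n \<le> N\<close> Na(1)])
    define ws where "ws = map (\<lambda>a. compose_range \<tau> 0 n [a]) us"
    have "compose_range \<tau> 0 N [a] = concat ws"
      using compose_range_split[of 0 n N \<tau>] \<open>n \<le> N\<close> semigroup_morphism_concat[OF mor us, of 0]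
      by (simp add: us_def ws_def)
    then obtain p q where pq: "concat ws = p @ map x [- int h..int h] @ q"
      using Na(2) by (auto simp: sublist_def)
    have wsW: "set ws \<subseteq> ?W" using us by (auto simp: ws_def level_words_def words_def)
    obtain C where C: "\<And>i. - int h + int m \<le> i \<Longrightarrow> i + int m \<le> int h \<Longrightarrow> parsed_at ?W x C i"
      using parsed_at_concat[OF wsW ne pq len] by blast
    show "\<exists>F. (\<forall>j<1::nat. \<forall>i. \<bar>i\<bar> \<le> int k \<longrightarrow> parsed_at ?W x (F j) i) \<and>
        (\<forall>j<1. \<forall>j'<1. j \<noteq> j' \<longrightarrow> F j \<inter> F j' \<inter> {- int k..int k} = {})"
      by (intro exI[of _ "\<lambda>_. C"]) (auto intro!: C simp: h_def)
  qed
  then show ?thesis by auto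
qed

text \<open>Finite rank gives a \<open>K\<close> that bounds the alphabets of infinitely many
  levels; growth makes all words long from some level on. So every \<open>l\<close> has a level with
  both properties, with the same \<open>K\<close>.\<close>

lemma finite_rank_parses:
  assumes ds: "directive_sequence A \<tau>" and gr: "everywhere_growing A \<tau>" and rk: "finite_alphabet_rank A"
  shows "\<exists>K. \<forall>l. \<exists>W. finite W \<and> card W \<le> K \<and> (\<forall>w\<in>W. l \<le> length w) \<and>
    (\<forall>x\<in>subshift A \<tau>. \<exists>C. parse W x C)"
proof -
  have finA: "finite (A N)" for N using ds by (simp add: directive_sequence_def)
  have "\<exists>K. \<exists>\<^sub>F n in sequentially. card (A n) \<le> K"
  proof (rule ccontr)
    assume "\<not> ?thesis"
    then have "\<forall>\<^sub>F n in sequentially. K < card (A n)" for K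
      by (simp add: not_frequently not_le)
    then have "\<forall>\<^sub>F n in sequentially. enat K \<le> enat (card (A n))" for K
      by (rule eventually_mono[of "\<lambda>n. K < card (A n)"]) simp
    then have "enat K \<le> liminf (\<lambda>n. enat (card (A n)))" for K
      by (rule Liminf_bounded)
    then have "liminf (\<lambda>n. enat (card (A n))) = \<infinity>"
      by (metis enat_ord_simps(4) enat_ord_simps(5) infinity_ileE less_le_not_le not_infinity_eq Suc_ile_eq)
    then show False using rk by (simp add: finite_alphabet_rank_def)
  qed
  then obtain K where K: "\<exists>\<^sub>F n in sequentially. card (A n) \<le> K" by blast
  have "\<exists>W. finite W \<and> card W \<le> K \<and> (\<forall>w\<in>W. l \<le> length w) \<and> (\<forall>x\<in>subshift A \<tau>. \<exists>C. parse W x C)" for l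
  proof -
    have "\<forall>\<^sub>F n in sequentially. l \<le> min_length (A n) (compose_range \<tau> 0 n)"
      using gr by (simp add: everywhere_growing_def filterlim_at_top)
    then obtain n where n: "card (A n) \<le> K" "l \<le> min_length (A n) (compose_range \<tau> 0 n)"
      using frequently_ex[OF frequently_eventually_frequently[OF K]] by blast
    have "l \<le> length w" if "w \<in> level_words A \<tau> n" for w
    proof -
      from that obtain a where "a \<in> A n" "w = compose_range \<tau> 0 n [a]" by (auto simp: level_words_def)
      then have "min_length (A n) (compose_range \<tau> 0 n) \<le> length w"
        unfolding min_length_def by (intro Min_le) (use finA in auto)
      then show ?thesis using n by simp
    qed
    moreover have "card (level_words A \<tau> n) \<le> K"
      using n(1) card_image_le[OF finA] unfolding level_words_def by (rule order.trans[rotated])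
    moreover have "finite (level_words A \<tau> n)" using finA by (simp add: level_words_def)
    ultimately show ?thesis using subshift_parsable[OF ds, of _ n] by blast
  qed
  then show ?thesis by blast
qed

section \<open>The S-adic subshift as a topological system\<close>

lemma subshift_closed:
  assumes v: "\<And>k::nat. \<exists>x\<in>subshift A \<tau>. \<forall>i. \<bar>i\<bar> \<le> int k \<longrightarrow> x i = v i"
  shows "v \<in> subshift A \<tau>"
  unfolding subshift_def mem_Collect_eq
proof (intro conjI allI)
  fix i
  from v[of "nat \<bar>i\<bar>"] obtain x where x: "x \<in> subshift A \<tau>" "\<forall>j. \<bar>j\<bar> \<le> int (nat \<bar>i\<bar>) \<longrightarrow> x j = v j" by blast
  then have "x i = v i" by simp
  then show "v i \<in> A 0" using x(1) unfolding subshift_def by (metis (mono_tags, lifting) mem_Collect_eq)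
next
  fix k :: nat
  from v[of k] obtain x where x: "x \<in> subshift A \<tau>" "\<forall>i. \<bar>i\<bar> \<le> int k \<longrightarrow> x i = v i" by blast
  have eq: "map v [- int k..int k] = map x [- int k..int k]" using x(2) by (auto simp: abs_le_iff)
  then show "\<exists>N>0. \<exists>a\<in>A N. sublist (map v [- int k..int k]) (compose_range \<tau> 0 N [a])"
    unfolding eq using x(1) by (simp add: subshift_def)
qed

section \<open>Cylinders and the topology\<close>

lemma openin_cylinder:
  assumes "u \<in> subshift A \<tau>"
  shows "openin (subshift_topology A \<tau>) {v \<in> subshift A \<tau>. \<forall>i. \<bar>i\<bar> \<le> int k \<longrightarrow> v i = u i}"
proof -
  let ?P = "product_topology (\<lambda>_. discrete_topology (A 0)) (UNIV :: int set)"
  define U where "U i = (if \<bar>i\<bar> \<le> int k then {u i} else A 0)" for i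
  have A: "v i \<in> A 0" if "v \<in> subshift A \<tau>" for v i using that by (simp add: subshift_def)
  have "openin ?P (\<Pi>\<^sub>E i\<in>UNIV. U i)"
  proof (rule product_topology_basis)
    show "openin (discrete_topology (A 0)) (U i)" for i using A[OF assms] by (simp add: U_def)
    have "{i. U i \<noteq> topspace (discrete_topology (A 0))} \<subseteq> {- int k..int k}" by (auto simp: U_def)
    then show "finite {i. U i \<noteq> topspace (discrete_topology (A 0))}" using finite_subset by blast
  qed
  moreover have "{v \<in> subshift A \<tau>. \<forall>i. \<bar>i\<bar> \<le> int k \<longrightarrow> v i = u i} = (\<Pi>\<^sub>E i\<in>UNIV. U i) \<inter> subshift A \<tau>"
    using A by (auto simp: U_def PiE_UNIV_domain split: if_splits)
  ultimately show ?thesis unfolding subshift_topology_def openin_subtopology by blast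
qed

text \<open>A basic open set of the product restricts finitely many coordinates, and a central
  window covers them.\<close>

lemma cylinder_in_open:
  assumes S: "openin (subshift_topology A \<tau>) S" and u: "u \<in> S"
  shows "\<exists>k::nat. \<forall>v\<in>subshift A \<tau>. (\<forall>i. \<bar>i\<bar> \<le> int k \<longrightarrow> v i = u i) \<longrightarrow> v \<in> S"
proof -
  let ?P = "product_topology (\<lambda>_. discrete_topology (A 0)) (UNIV :: int set)"
  from S obtain Q where Q: "openin ?P Q" "S = Q \<inter> subshift A \<tau>"
    unfolding subshift_topology_def openin_subtopology by blast
  then obtain U where U: "finite {i. U i \<noteq> A 0}" "u \<in> Pi\<^sub>E UNIV U" "Pi\<^sub>E UNIV U \<subseteq> Q"
    using u unfolding openin_product_topology_alt by auto
  define k where "k = Max (insert 0 ((\<lambda>i. nat \<bar>i\<bar>) ` {i. U i \<noteq> A 0}))"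
  have k: "\<bar>i\<bar> \<le> int k" if "U i \<noteq> A 0" for i
  proof -
    have "nat \<bar>i\<bar> \<le> k" unfolding k_def by (rule Max_ge) (use U(1) that in auto)
    then show ?thesis by simp
  qed
  show ?thesis
  proof (intro exI[of _ k] ballI impI)
    fix v assume v: "v \<in> subshift A \<tau>" "\<forall>i. \<bar>i\<bar> \<le> int k \<longrightarrow> v i = u i"
    have "v i \<in> U i" for i
    proof (cases "U i = A 0")
      case True
      then show ?thesis using v(1) by (simp add: subshift_def)
    next
      case False
      have "u i \<in> U i" using U(2) by (auto simp: PiE_def Pi_def)
      then show ?thesis using v(2) k[OF False] by simp
    qed
    then show "v \<in> S" using U(3) Q(2) v(1) by (auto simp: PiE_UNIV_domain)
  qed
qed

lemma minimal_subshift_subshift: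
  assumes ds: "directive_sequence A \<tau>"
    and min: "minimal_system (subshift_topology A \<tau>) (shift (subshift A \<tau>))"
  shows "minimal_subshift (subshift A \<tau>) (A 0)"
proof
  show "finite (A 0)" using ds by (simp add: directive_sequence_def)
  show "x i \<in> A 0" if "x \<in> subshift A \<tau>" for x i using that by (simp add: subshift_def)
  show "v \<in> subshift A \<tau>" if "\<And>k::nat. \<exists>x\<in>subshift A \<tau>. \<forall>i. \<bar>i\<bar> \<le> int k \<longrightarrow> x i = v i" for v
    using that by (rule subshift_closed)
  show "(\<lambda>i. x (i + n)) \<in> subshift A \<tau>" if "x \<in> subshift A \<tau>" for x n
    using that by (rule subshift_translate)
  show "\<exists>n. \<forall>i. \<bar>i\<bar> \<le> int k \<longrightarrow> x (i + n) = u i" if x: "x \<in> subshift A \<tau>" and u: "u \<in> subshift A \<tau>" for x u k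
  proof -
    let ?S = "{(shift (subshift A \<tau>) [^]\<^bsub>BijGroup (subshift A \<tau>)\<^esub> n) x |n::int. True}"
    have "u \<in> subshift_topology A \<tau> closure_of ?S"
      using min x u by (simp add: minimal_system_def)
    then have "\<And>U. u \<in> U \<Longrightarrow> openin (subshift_topology A \<tau>) U \<Longrightarrow> \<exists>y. y \<in> ?S \<and> y \<in> U"
      by (simp add: in_closure_of)
    from this[OF _ openin_cylinder[OF u, of k]]
    obtain y where "y \<in> ?S" "\<forall>i. \<bar>i\<bar> \<le> int k \<longrightarrow> y i = u i"
      using u by auto
    then show ?thesis by (auto simp: shift_int_pow[OF x])
  qed
qed

section \<open>Automorphisms as block codes\<close>

lemma Aut_translate:
  assumes \<phi>: "\<phi> \<in> carrier (Aut (subshift_topology A \<tau>) (shift (subshift A \<tau>)))"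
    and x: "x \<in> subshift A \<tau>"
  shows "\<phi> (\<lambda>i. x (i + n)) = (\<lambda>i. \<phi> x (i + n))"
proof -
  have step: "\<phi> (\<lambda>i. y (i + 1)) = (\<lambda>i. \<phi> y (i + 1))" if y: "y \<in> subshift A \<tau>" for y
  proof -
    have "\<phi> y \<in> subshift A \<tau>" using \<phi> y by (auto simp: Aut_def Bij_def bij_betw_def)
    moreover have "\<phi> (shift (subshift A \<tau>) y) = shift (subshift A \<tau>) (\<phi> y)"
      using \<phi> y by (simp add: Aut_def)
    ultimately show ?thesis using y by (simp add: shift_def)
  qed
  show ?thesis
  proof (induction n rule: int_induct[where k = 0])
    case (step1 n)
    then show ?case using step[OF subshift_translate[OF x, of n]] by (simp add: add.assoc add.commute[of 1 n])
  next
    case (step2 n)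
    have "\<phi> (\<lambda>i. x (i + n)) = (\<lambda>i. \<phi> (\<lambda>i. x (i + (n - 1))) (i + 1))"
      using step[OF subshift_translate[OF x, of "n - 1"]] by (simp add: algebra_simps)
    then have "\<phi> x (i + n) = \<phi> (\<lambda>i. x (i + (n - 1))) (i + 1)" for i
      using step2 by metis
    then have "\<phi> x (i - 1 + n) = \<phi> (\<lambda>i. x (i + (n - 1))) i" for i
      by (metis diff_add_cancel)
    then show ?case by (simp add: fun_eq_iff algebra_simps)
  qed simp
qed

text \<open>The Curtis-Hedlund-Lyndon theorem. Continuity gives a window at each point; if none were
  uniform, pairs agreeing on ever larger windows would accumulate at a point \<open>g\<close> and
  contradict the window of \<open>g\<close>.\<close>

lemma Aut_block_code:
  assumes X: "minimal_subshift (subshift A \<tau>) (A 0)"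
    and \<phi>: "\<phi> \<in> carrier (Aut (subshift_topology A \<tau>) (shift (subshift A \<tau>)))"
  shows "\<exists>N::nat. \<forall>u\<in>subshift A \<tau>. \<forall>v\<in>subshift A \<tau>. \<forall>i.
    (\<forall>j. \<bar>j - i\<bar> \<le> int N \<longrightarrow> u j = v j) \<longrightarrow> \<phi> u i = \<phi> v i"
proof -
  interpret minimal_subshift "subshift A \<tau>" "A 0" by (rule X)
  let ?X = "subshift A \<tau>" and ?Z = "subshift_topology A \<tau>"
  have cont: "continuous_map ?Z ?Z \<phi>" using \<phi> by (simp add: Aut_def homeomorphic_imp_continuous_map)
  have \<phi>X: "\<phi> y \<in> ?X" if "y \<in> ?X" for y using \<phi> that by (auto simp: Aut_def Bij_def bij_betw_def)
  have local: "\<exists>k::nat. \<forall>v\<in>?X. (\<forall>i. \<bar>i\<bar> \<le> int k \<longrightarrow> v i = u i) \<longrightarrow> \<phi> v 0 = \<phi> u 0" if u: "u \<in> ?X" for u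
  proof -
    let ?O = "{v \<in> ?X. \<phi> v \<in> {w \<in> ?X. \<forall>i. \<bar>i\<bar> \<le> int 0 \<longrightarrow> w i = \<phi> u i}}"
    have "openin ?Z ?O"
      using openin_continuous_map_preimage[OF cont openin_cylinder[OF \<phi>X[OF u], of 0]] by simp
    moreover have "u \<in> ?O" using u \<phi>X by simp
    ultimately obtain k where "\<forall>v\<in>?X. (\<forall>i. \<bar>i\<bar> \<le> int k \<longrightarrow> v i = u i) \<longrightarrow> v \<in> ?O"
      using cylinder_in_open by blast
    then show ?thesis by auto
  qed
  have "\<exists>N::nat. \<forall>u\<in>?X. \<forall>v\<in>?X. (\<forall>j. \<bar>j\<bar> \<le> int N \<longrightarrow> u j = v j) \<longrightarrow> \<phi> u 0 = \<phi> v 0"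
  proof (rule ccontr)
    assume "\<not> ?thesis"
    then have "\<forall>N::nat. \<exists>u v. u \<in> ?X \<and> v \<in> ?X \<and> (\<forall>j. \<bar>j\<bar> \<le> int N \<longrightarrow> u j = v j) \<and> \<phi> u 0 \<noteq> \<phi> v 0"
      by blast
    then obtain u v where uv: "\<And>N. u N \<in> ?X" "\<And>N. v N \<in> ?X"
        "\<And>N j. \<bar>j\<bar> \<le> int N \<Longrightarrow> u N j = v N j" "\<And>N. \<phi> (u N) 0 \<noteq> \<phi> (v N) 0"
      by metis
    obtain g where g: "\<And>m. infinite {N. \<forall>i. \<bar>i\<bar> \<le> int m \<longrightarrow> u N i = g i}"
      by (rule konig_int[of "A 0" u]) (use finite_alphabet letters uv in auto)
    have "g \<in> ?X" by (rule limit_in_X[OF _ g]) (rule uv)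
    from local[OF this] obtain k where k: "\<And>w. w \<in> ?X \<Longrightarrow> (\<And>i. \<bar>i\<bar> \<le> int k \<Longrightarrow> w i = g i) \<Longrightarrow> \<phi> w 0 = \<phi> g 0"
      by blast
    obtain N where N: "N \<ge> k" "\<And>i. \<bar>i\<bar> \<le> int k \<Longrightarrow> u N i = g i"
      using g[of k] unfolding infinite_nat_iff_unbounded_le by blast
    have "v N i = g i" if "\<bar>i\<bar> \<le> int k" for i
      using uv(3)[of i N] N that by simp
    then have "\<phi> (u N) 0 = \<phi> (v N) 0" using k[OF uv(1)] k[OF uv(2)] N(2) by metis
    then show False using uv(4) by blast
  qed
  then obtain N where N: "\<And>u v. u \<in> ?X \<Longrightarrow> v \<in> ?X \<Longrightarrow> (\<And>j. \<bar>j\<bar> \<le> int N \<Longrightarrow> u j = v j) \<Longrightarrow> \<phi> u 0 = \<phi> v 0"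
    by blast
  show ?thesis
  proof (intro exI[of _ N] ballI allI impI)
    fix u v i assume uv: "u \<in> ?X" "v \<in> ?X" "\<forall>j. \<bar>j - i\<bar> \<le> int N \<longrightarrow> u j = v j"
    have "\<phi> (\<lambda>j. u (j + i)) 0 = \<phi> (\<lambda>j. v (j + i)) 0"
      by (rule N[OF translate[OF uv(1)] translate[OF uv(2)]]) (use uv(3) in auto)
    then show "\<phi> u i = \<phi> v i" by (simp add: Aut_translate[OF \<phi>] uv)
  qed
qed

section \<open>Automorphisms\<close>

text \<open>A block code sends points that agree on the right half line to points that agree far
  enough to the right, and injectivity keeps the images distinct. Translating by \<open>q\<close>
  puts their rightmost disagreement at -1.\<close>

lemma Aut_special_tail:
  assumes X: "minimal_subshift (subshift A \<tau>) (A 0)"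
    and \<phi>: "\<phi> \<in> carrier (Aut (subshift_topology A \<tau>) (shift (subshift A \<tau>)))"
    and xy: "x \<in> subshift A \<tau>" "y \<in> subshift A \<tau>" "x \<noteq> y" "\<And>i. 0 \<le> i \<Longrightarrow> x i = y i"
  shows "\<exists>q. (\<lambda>j. \<phi> x (int j + q)) \<in> minimal_subshift.special_tails (subshift A \<tau>)"
proof -
  interpret minimal_subshift "subshift A \<tau>" "A 0" by (rule X)
  obtain N where N: "\<And>u v i. u \<in> subshift A \<tau> \<Longrightarrow> v \<in> subshift A \<tau> \<Longrightarrow>
      (\<And>j. \<bar>j - i\<bar> \<le> int N \<Longrightarrow> u j = v j) \<Longrightarrow> \<phi> u i = \<phi> v i"
    using Aut_block_code[OF X \<phi>] by blast
  have bij: "bij_betw \<phi> (subshift A \<tau>) (subshift A \<tau>)"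
    using \<phi> by (simp add: Aut_def Bij_def)
  have "\<phi> x \<noteq> \<phi> y" using bij xy by (metis bij_betw_inv_into_left)
  then obtain i0 where i0: "\<phi> x i0 \<noteq> \<phi> y i0" by blast
  have right: "\<phi> x i = \<phi> y i" if "int N \<le> i" for i
    by (rule N) (use xy that in auto)
  \<comment> \<open>Positions are counted leftwards from \<open>N\<close>, so the least
    \<open>n\<close> marks the rightmost disagreement.\<close>
  define P where "P n \<longleftrightarrow> \<phi> x (int N - int n) \<noteq> \<phi> y (int N - int n)" for n
  have "P (nat (int N - i0))" using i0 right[of i0] by (cases "i0 \<le> int N") (auto simp: P_def)
  then have P: "P (LEAST n. P n)" by (rule LeastI)
  define q where "q = int N - int (LEAST n. P n) + 1"
  have eq: "\<phi> x i = \<phi> y i" if "q \<le> i" for i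
  proof (cases "int N \<le> i")
    case False
    then have "nat (int N - i) < (LEAST n. P n)" using that by (simp add: q_def)
    from not_less_Least[OF this] show ?thesis using False by (simp add: P_def)
  qed (rule right)
  have in_X: "\<phi> u \<in> subshift A \<tau>" if "u \<in> subshift A \<tau>" for u
    using bij that by (auto simp: bij_betw_def)
  have "(\<lambda>j. (\<lambda>i. \<phi> x (i + q)) (int j)) \<in> special_tails"
    unfolding special_tails_def
  proof (intro CollectI exI conjI bexI)
    show "(\<lambda>i. \<phi> x (i + q)) \<in> subshift A \<tau>" "(\<lambda>i. \<phi> y (i + q)) \<in> subshift A \<tau>"
      using in_X xy translate by auto
    show "\<phi> x (- 1 + q) \<noteq> \<phi> y (- 1 + q)" using P by (simp add: P_def q_def)
    show "\<forall>i\<ge>0. \<phi> x (i + q) = \<phi> y (i + q)" using eq by simp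
  qed simp
  then show ?thesis by blast
qed

text \<open>Two automorphisms that agree along one forward orbit up to a translation agree everywhere,
  since every point is a limit of that forward orbit.\<close>

lemma Aut_eq_if_eq_on_ray:
  assumes X: "minimal_subshift (subshift A \<tau>) (A 0)"
    and \<phi>: "\<phi> \<in> carrier (Aut (subshift_topology A \<tau>) (shift (subshift A \<tau>)))"
    and \<psi>: "\<psi> \<in> carrier (Aut (subshift_topology A \<tau>) (shift (subshift A \<tau>)))"
    and x: "x \<in> subshift A \<tau>" and u: "u \<in> subshift A \<tau>"
    and eq: "\<And>j::nat. \<phi> x (int j + p) = \<psi> x (int j + q)"
  shows "\<phi> u (i + p) = \<psi> u (i + q)"
proof -
  interpret minimal_subshift "subshift A \<tau>" "A 0" by (rule X)
  obtain N where N: "\<And>u v i. u \<in> subshift A \<tau> \<Longrightarrow> v \<in> subshift A \<tau> \<Longrightarrow>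
      (\<And>j. \<bar>j - i\<bar> \<le> int N \<Longrightarrow> u j = v j) \<Longrightarrow> \<phi> u i = \<phi> v i"
    using Aut_block_code[OF X \<phi>] by blast
  obtain M where M: "\<And>u v i. u \<in> subshift A \<tau> \<Longrightarrow> v \<in> subshift A \<tau> \<Longrightarrow>
      (\<And>j. \<bar>j - i\<bar> \<le> int M \<Longrightarrow> u j = v j) \<Longrightarrow> \<psi> u i = \<psi> v i"
    using Aut_block_code[OF X \<psi>] by blast
  \<comment> \<open>\<open>k\<close> covers both coding windows;
    \<open>n \<ge> \<bar>i\<bar>\<close> below makes \<open>i + n\<close> nonnegative, as the
    hypothesis on the ray requires.\<close>
  define k where "k = N + M + nat \<bar>i + p\<bar> + nat \<bar>i + q\<bar>"
  obtain n where n: "n \<ge> \<bar>i\<bar>" "\<And>j. \<bar>j\<bar> \<le> int k \<Longrightarrow> x (j + n) = u j"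
    using forward_recurrence[OF x u] by blast
  have i: "int (nat (i + n)) = i + n" using n(1) by simp
  have "\<phi> u (i + p) = \<phi> (\<lambda>j. x (j + n)) (i + p)"
    by (rule N[OF u translate[OF x]], rule n(2)[symmetric]) (auto simp: k_def)
  also have "\<dots> = \<phi> x (int (nat (i + n)) + p)"
    by (simp only: Aut_translate[OF \<phi> x] i) (simp add: algebra_simps)
  also have "\<dots> = \<psi> x (int (nat (i + n)) + q)" by (rule eq)
  also have "\<dots> = \<psi> (\<lambda>j. x (j + n)) (i + q)"
    by (simp only: Aut_translate[OF \<psi> x] i) (simp add: algebra_simps)
  also have "\<dots> = \<psi> u (i + q)"
    by (rule M[OF translate[OF x] u], rule n(2)) (auto simp: k_def)
  finally show ?thesis .
qed

section \<open>Translations and cosets\<close>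

lemma translation_in_generate:
  fixes A :: "nat \<Rightarrow> 'a set" and \<tau> :: "nat \<Rightarrow> 'a list \<Rightarrow> 'a list"
  defines "G \<equiv> Aut (subshift_topology A \<tau>) (shift (subshift A \<tau>))"
  shows "(\<lambda>x\<in>subshift A \<tau>. \<lambda>i. x (i + n)) \<in> generate G {shift (subshift A \<tau>)}"
proof -
  let ?X = "subshift A \<tau>" and ?T = "shift (subshift A \<tau>)"
  interpret G: group G
    unfolding G_def by (rule group_Aut) (simp add: shift_Bij)
  have TG: "?T \<in> carrier G" unfolding G_def by (rule shift_in_Aut)
  have sub: "subgroup (generate G {?T}) G" using TG by (intro G.generate_is_subgroup) auto
  define S where "S n = (\<lambda>x\<in>?X. \<lambda>i. x (i + n))" for n :: int
  have mult: "f \<otimes>\<^bsub>G\<^esub> g = compose ?X f g" if "f \<in> carrier G" "g \<in> carrier G" for f g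
    using that by (auto simp: G_def Aut_def BijGroup_def)
  have SS: "compose ?X (S m) (S n) = S (m + n)" for m n
    by (rule ext) (auto simp: compose_def S_def restrict_def add_ac dest: subshift_translate[where j = n])
  have one: "\<one>\<^bsub>G\<^esub> = S 0" by (auto simp: G_def Aut_def BijGroup_def S_def)
  have T: "?T = S 1" by (simp add: shift_def S_def)
  have "S n \<in> generate G {?T}"
  proof (induction n rule: int_induct[where k = 0])
    case base
    show ?case using generate.one[of G "{?T}"] one by simp
  next
    case (step1 n)
    then have "?T \<otimes>\<^bsub>G\<^esub> S n \<in> generate G {?T}"
      by (intro generate.eng[OF generate.incl]) auto
    moreover have "?T \<otimes>\<^bsub>G\<^esub> S n = S (n + 1)"
      using mult[OF TG subgroup.mem_carrier[OF sub step1.IH]] SS[of 1 n] T by (simp add: add.commute)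
    ultimately show ?case by simp
  next
    case (step2 n)
    have nG: "S n \<in> carrier G" by (rule subgroup.mem_carrier[OF sub step2.IH])
    have "inv\<^bsub>G\<^esub> ?T \<in> generate G {?T}" by (rule generate.inv) simp
    then have "inv\<^bsub>G\<^esub> ?T \<otimes>\<^bsub>G\<^esub> S n \<in> generate G {?T}"
      by (rule generate.eng) (rule step2.IH)
    moreover have "inv\<^bsub>G\<^esub> ?T \<otimes>\<^bsub>G\<^esub> S n = S (n - 1)"
    proof -
      \<comment> \<open>Instead of computing the inverse of the shift, \<open>f\<close> is recovered
        from \<open>compose ?X ?T f = S n\<close> by composing with \<open>S (-1)\<close>.\<close>
      define f where "f = inv\<^bsub>G\<^esub> ?T \<otimes>\<^bsub>G\<^esub> S n"
      have fG: "f \<in> carrier G" using nG TG by (simp add: f_def)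
      have "?T \<otimes>\<^bsub>G\<^esub> f = S n" using nG TG by (simp add: f_def G.m_assoc[symmetric])
      then have c: "compose ?X ?T f = S n" using mult[OF TG fG] by simp
      have f: "f \<in> extensional ?X" "\<And>x. x \<in> ?X \<Longrightarrow> f x \<in> ?X"
        using fG by (auto simp: G_def Aut_def Bij_def bij_betw_def)
      have "f = compose ?X (S (-1)) (compose ?X ?T f)"
      proof (rule ext)
        fix x
        show "f x = compose ?X (S (-1)) (compose ?X ?T f) x"
        proof (cases "x \<in> ?X")
          case True
          have "(\<lambda>i. f x (i + 1)) \<in> ?X" by (rule subshift_translate[OF f(2)[OF True]])
          then show ?thesis using True f(2)[OF True] by (simp add: compose_def S_def shift_def)
        next
          case False
          then show ?thesis using f(1) by (simp add: extensional_def compose_def)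
        qed
      qed
      also have "\<dots> = S (n - 1)" unfolding c SS by simp
      finally show ?thesis by (simp add: f_def)
    qed
    ultimately show ?case by simp
  qed
  then show ?thesis by (simp add: S_def)
qed

lemma finite_rcosets:
  assumes "finite (key ` carrier G)"
    and "\<And>a b. a \<in> carrier G \<Longrightarrow> b \<in> carrier G \<Longrightarrow> key a = key b \<Longrightarrow> H #>\<^bsub>G\<^esub> a = H #>\<^bsub>G\<^esub> b"
  shows "finite (rcosets\<^bsub>G\<^esub> H)"
proof -
  define pick where "pick z = (SOME a. a \<in> carrier G \<and> key a = z)" for z
  have "rcosets\<^bsub>G\<^esub> H \<subseteq> (\<lambda>z. H #>\<^bsub>G\<^esub> pick z) ` (key ` carrier G)"
  proof
    fix K assume "K \<in> rcosets\<^bsub>G\<^esub> H"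
    then obtain a where a: "a \<in> carrier G" "K = H #>\<^bsub>G\<^esub> a" by (auto simp: RCOSETS_def)
    then have "pick (key a) \<in> carrier G \<and> key (pick (key a)) = key a"
      unfolding pick_def by (intro someI_ex[of "\<lambda>b. b \<in> carrier G \<and> key b = key a"]) blast
    then have "K = H #>\<^bsub>G\<^esub> pick (key a)" using assms(2) a by metis
    then show "K \<in> (\<lambda>z. H #>\<^bsub>G\<^esub> pick z) ` (key ` carrier G)" using a(1) by blast
  qed
  then show ?thesis using assms(1) finite_subset by blast
qed

theorem theorem1p1:
  fixes A :: "nat \<Rightarrow> 'a set"
    and \<tau> :: "nat \<Rightarrow> 'a list \<Rightarrow> 'a list"
  assumes "directive_sequence A \<tau>"
    and "everywhere_growing A \<tau>"
    and "finite_alphabet_rank A"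
    and "minimal_system (subshift_topology A \<tau>) (shift (subshift A \<tau>))"
  shows "virtually_Z (subshift_topology A \<tau>) (shift (subshift A \<tau>))"
proof -
  let ?X = "subshift A \<tau>" and ?T = "shift (subshift A \<tau>)"
  define G where "G = Aut (subshift_topology A \<tau>) ?T"
  define H where "H = generate G {?T}"
  have ms: "minimal_subshift ?X (A 0)" by (rule minimal_subshift_subshift[OF assms(1,4)])
  interpret minimal_subshift ?X "A 0" by (rule ms)
  interpret G: group G
    unfolding G_def by (rule group_Aut) (simp add: shift_Bij)
  have TG: "?T \<in> carrier G" unfolding G_def by (rule shift_in_Aut)
  have sub: "subgroup H G" unfolding H_def using TG by (intro G.generate_is_subgroup) auto
  have "finite (rcosets\<^bsub>G\<^esub> H)"
  proof (cases "finite ?X")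
    case True
    \<comment> \<open>A finite subshift has only finitely many self-maps, so the group itself is
      finite.\<close>
    have "carrier G \<subseteq> (\<Pi>\<^sub>E x\<in>?X. ?X)"
      by (auto simp: G_def Aut_def Bij_def PiE_def bij_betw_def)
    then have "finite (carrier G)" using True finite_PiE[of ?X "\<lambda>_. ?X"] finite_subset by blast
    then show ?thesis by (intro finite_rcosets[of "\<lambda>a. a"]) auto
  next
    case False
    then obtain x y where xy: "x \<in> ?X" "y \<in> ?X" "\<And>i. 0 \<le> i \<Longrightarrow> x i = y i" "x (-1) \<noteq> y (-1)"
      using finite_if_left_deterministic by blast
    have "finite special_tails"
      using finite_rank_parses[OF assms(1,2,3)] finite_special_tails by blast
    moreover have "\<exists>q. (\<lambda>j. \<phi> x (int j + q)) \<in> special_tails" if "\<phi> \<in> carrier G" for \<phi>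
      using Aut_special_tail[OF ms _ xy(1,2) _ xy(3)] that xy(4) unfolding G_def by auto
    then obtain q where q: "\<And>\<phi>. \<phi> \<in> carrier G \<Longrightarrow> (\<lambda>j. \<phi> x (int j + q \<phi>)) \<in> special_tails"
      by metis
    \<comment> \<open>The invariant of an automorphism: the special tail cut from
      \<open>\<phi> x\<close> at the chosen offset \<open>q \<phi>\<close>. Equal keys will give
      equal cosets.\<close>
    define key where "key \<phi> = (\<lambda>j. \<phi> x (int j + q \<phi>))" for \<phi> :: "(int \<Rightarrow> 'a) \<Rightarrow> int \<Rightarrow> 'a"
    have "key ` carrier G \<subseteq> special_tails" using q by (auto simp: key_def)
    ultimately have "finite (key ` carrier G)" by (rule rev_finite_subset)
    then show ?thesis
    proof (rule finite_rcosets)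
      fix \<phi> \<psi> assume \<phi>: "\<phi> \<in> carrier G" and \<psi>: "\<psi> \<in> carrier G" and eq: "key \<phi> = key \<psi>"
      define S where "S n = (\<lambda>x\<in>?X. \<lambda>i. x (i + n))" for n :: int
      have S: "S n \<in> H" for n unfolding S_def H_def G_def by (rule translation_in_generate)
      have SG: "S n \<in> carrier G" for n by (rule subgroup.mem_carrier[OF sub S])
      have mult: "S n \<otimes>\<^bsub>G\<^esub> f = compose ?X (S n) f" if "f \<in> carrier G" for n f
        using SG that by (auto simp: G_def Aut_def BijGroup_def)
      have in_X: "f u \<in> ?X" if "f \<in> carrier G" "u \<in> ?X" for f u
        using that by (auto simp: G_def Aut_def Bij_def bij_betw_def)
      \<comment> \<open>Equal keys mean equality along a forward ray of the images of
        \<open>x\<close>, up to translation; this spreads to every point \<open>u\<close>.\<close>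
      have "S (q \<phi>) \<otimes>\<^bsub>G\<^esub> \<phi> = S (q \<psi>) \<otimes>\<^bsub>G\<^esub> \<psi>"
        unfolding mult[OF \<phi>] mult[OF \<psi>]
      proof (rule ext)
        fix u
        show "compose ?X (S (q \<phi>)) \<phi> u = compose ?X (S (q \<psi>)) \<psi> u"
        proof (cases "u \<in> ?X")
          case True
          have "\<phi> u (i + q \<phi>) = \<psi> u (i + q \<psi>)" for i
            by (rule Aut_eq_if_eq_on_ray[OF ms _ _ xy(1) True])
               (use \<phi> \<psi> eq in \<open>auto simp: G_def key_def fun_eq_iff\<close>)
          then show ?thesis using True in_X[OF \<phi>] in_X[OF \<psi>] by (simp add: compose_def S_def)
        qed (simp add: compose_def)
      qed
      then have "H #>\<^bsub>G\<^esub> (S (q \<phi>) \<otimes>\<^bsub>G\<^esub> \<phi>) = H #>\<^bsub>G\<^esub> (S (q \<psi>) \<otimes>\<^bsub>G\<^esub> \<psi>)" by simp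
      \<comment> \<open>Translations lie in \<open>H\<close>, so the coset absorbs them.\<close>
      moreover have "H #>\<^bsub>G\<^esub> (S n \<otimes>\<^bsub>G\<^esub> f) = H #>\<^bsub>G\<^esub> f" if "f \<in> carrier G" for n f
        using G.coset_mult_assoc[OF subgroup.subset[OF sub] SG that] G.coset_join2[OF SG sub S] by simp
      ultimately show "H #>\<^bsub>G\<^esub> \<phi> = H #>\<^bsub>G\<^esub> \<psi>" using \<phi> \<psi> by metis
    qed
  qed
  then show ?thesis by (simp add: virtually_Z_def FactGroup_def G_def H_def)
qed

end
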